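(* Let $n\ge 2$ be an integer and let $k,j\ge 0$ be integers. The dimension over $\mathbb{C}$ of the dihedral coinvariant ring $R^{(k,j)}_{\mathfrak{I}_2(n)}$ is $$1+ \binom{k}{2} + kj + \binom{j+1}{2} + \sum_{h=0}^n \binom{j}{h}\binom{k+n-h-1}{n-h} + 2\sum_{i=1}^{n-1} \sum_{h=0}^i \binom{j}{h}\binom{k+i-h-1}{i-h}.$$
   Context: **The group.** $\mathfrak{I}_2(n)$ is the dihedral group of order $2n$, realized inside $\mathrm{GL}_2(\mathbb{C})$ as generated by $$\rho=\begin{bmatrix}\cos\frac{2\pi}{n}&-\sin\frac{2\pi}{n}\\ \sin\frac{2\pi}{n}&\cos\frac{2\pi}{n}\end{bmatrix},\qquad \phi=\begin{bmatrix}1&0\\0&-1\end{bmatrix}.$$ **The ring.** Let $S=\mathbb{C}[\boldsymbol{x}^{(1)},\ldots,\boldsymbol{x}^{(k)},\boldsymbol{\theta}^{(1)},\ldots,\boldsymbol{\theta}^{(j)}]$ be the $\mathbb{C}$-algebra generated by commuting (bosonic) variables $x_1^{(a)},x_2^{(a)}$ ($1\le a\le k$) and anticommuting (fermionic) variables $\theta_1^{(b)},\theta_2^{(b)}$ ($1\le b\le j$). The bosonic variables commute with all variables; the fermionic variables anticommute with each other, and in particular square to zero. The group $\mathfrak{I}_2(n)$ acts diagonally on $S$ by algebra automorphisms: each $g$ acts on each pair $(x_1^{(a)},x_2^{(a)})$ and each pair $(\theta_1^{(b)},\theta_2^{(b)})$ as a basis of $\mathbb{C}^2$ through the $2\times2$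 matrix of $g$, i.e. $g\cdot v_s=\sum_r g_{rs}v_r$. Let $I^{(k,j)}_{\mathfrak{I}_2(n)}$ be the ideal of $S$ generated by all $\mathfrak{I}_2(n)$-invariant elements with zero constant term, and let $R^{(k,j)}_{\mathfrak{I}_2(n)}=S/I^{(k,j)}_{\mathfrak{I}_2(n)}$. **Binomial convention.** $\binom{a}{0}=1$ for every integer $a$ (including $a=-1$, which occurs when $k=0$), and $\binom{a}{b}=0$ for integers $0\le a<b$. Thus $\binom{k+m-1}{m}$ is the number of monomials of degree $m$ in $k$ commuting variables. *)

theory Defs
  imports
    "HOL-Algebra.Embedded_Algebras"
    "HOL-Algebra.QuotRing"
    "HOL-Analysis.Determinants"
    "HOL-Library.Poly_Mapping"
begin

section \<open>The dihedral group as a matrix group\<close>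

definition GL2 :: "(complex^2^2) monoid" where
  "GL2 = \<lparr>carrier = {A. invertible A}, monoid.mult = (**), one = mat 1\<rparr>"

definition dihedral_rotation :: "nat \<Rightarrow> complex^2^2" where
  "dihedral_rotation n =
     (let t = 2 * pi / real n in
      vector [vector [complex_of_real (cos t), - complex_of_real (sin t)],
              vector [complex_of_real (sin t), complex_of_real (cos t)]])"

definition dihedral_reflection :: "complex^2^2" where
  "dihedral_reflection = vector [vector [1, 0], vector [0, -1]]"

definition dihedral_group :: "nat \<Rightarrow> (complex^2^2) set" where
  "dihedral_group n = generate GL2 {dihedral_rotation n, dihedral_reflection}"


section \<open>The superpolynomial ring\<close>

text \<open>
  The pair \<open>(a, r)\<close> indexes the variable with superscript \<open>a\<close> (counted from 1) and
  subscript \<open>r\<close>, for bosonic as well as fermionic variables. The two-element type \<open>2\<close> is the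
  index type of the \<open>2 \<times> 2\<close> matrices; its elements are \<open>1\<close> and \<open>2\<close>, where \<open>2 = 0\<close>.
\<close>

type_synonym var = "nat \<times> 2"

text \<open>Bosonic polynomials: a monomial is its finitely supported exponent function.\<close>

type_synonym bpoly = "(var \<Rightarrow>\<^sub>0 nat) \<Rightarrow>\<^sub>0 complex"

text \<open>
  A superpolynomial is written uniquely as a sum over sets \<open>F\<close> of \<open>p\<^sub>F \<theta>\<^sub>F\<close>, where \<open>p\<^sub>F\<close> is a
  bosonic polynomial and \<open>\<theta>\<^sub>F\<close> is the product of the fermionic variables in \<open>F\<close>, taken in the
  order \<open>\<theta>\<^sub>1\<^sup>1, \<theta>\<^sub>2\<^sup>1, \<theta>\<^sub>1\<^sup>2, \<theta>\<^sub>2\<^sup>2, \<dots>\<close> given by \<open>fpos\<close>.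
\<close>

type_synonym superpoly = "var set \<Rightarrow>\<^sub>0 bpoly"

definition fpos :: "var \<Rightarrow> nat" where
  "fpos v = 2 * fst v + (if snd v = 1 then 0 else 1)"

text \<open>
  For disjoint \<open>F\<close> and \<open>G\<close> one has \<open>\<theta>\<^sub>F \<theta>\<^sub>G = ferm_sign F G \<theta>\<^bsub>F \<union> G\<^esub>\<close>: sorting the factors takes
  one transposition of anticommuting variables for each pair that is out of order. If \<open>F\<close> and
  \<open>G\<close> share a variable, the product is zero.
\<close>

definition ferm_sign :: "var set \<Rightarrow> var set \<Rightarrow> bpoly" where
  "ferm_sign F G = (- 1) ^ card {(u, v). u \<in> F \<and> v \<in> G \<and> fpos v < fpos u}"

definition super_mult :: "superpoly \<Rightarrow> superpoly \<Rightarrow> superpoly" where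
  "super_mult p q =
     (\<Sum>F\<in>Poly_Mapping.keys p. \<Sum>G\<in>Poly_Mapping.keys q.
        if F \<inter> G = {}
        then Poly_Mapping.single (F \<union> G)
               (ferm_sign F G * Poly_Mapping.lookup p F * Poly_Mapping.lookup q G)
        else 0)"

definition bconst :: "complex \<Rightarrow> bpoly" where
  "bconst c = Poly_Mapping.single 0 c"

definition bvar :: "var \<Rightarrow> bpoly" where
  "bvar v = Poly_Mapping.single (Poly_Mapping.single v 1) 1"

definition super_of_bpoly :: "bpoly \<Rightarrow> superpoly" where
  "super_of_bpoly f = Poly_Mapping.single {} f"

definition super_const :: "complex \<Rightarrow> superpoly" where
  "super_const c = super_of_bpoly (bconst c)"

definition fvar :: "var \<Rightarrow> superpoly" where
  "fvar v = Poly_Mapping.single {v} 1"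

definition super_ring :: "nat \<Rightarrow> nat \<Rightarrow> superpoly ring" where
  "super_ring k j =
     \<lparr>carrier = {p. \<forall>F\<in>Poly_Mapping.keys p. F \<subseteq> {1..j} \<times> UNIV \<and>
                   (\<forall>m\<in>Poly_Mapping.keys (Poly_Mapping.lookup p F).
                      Poly_Mapping.keys m \<subseteq> {1..k} \<times> UNIV)},
      monoid.mult = super_mult, one = super_of_bpoly 1, zero = 0, add = (+)\<rparr>"

definition constant_term :: "superpoly \<Rightarrow> complex" where
  "constant_term p = Poly_Mapping.lookup (Poly_Mapping.lookup p {}) 0"


section \<open>The diagonal action\<close>

text \<open>
  A matrix \<open>g\<close> acts by the algebra endomorphism that sends each variable with index \<open>(a, s)\<close> to
  the sum over \<open>r\<close> of \<open>g\<^sub>r\<^sub>s\<close> times the variable with index \<open>(a, r)\<close>. Note that \<open>g\<^sub>r\<^sub>s\<close> is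
  \<open>g $ r $ s\<close>.
\<close>

definition act_bvar :: "complex^2^2 \<Rightarrow> var \<Rightarrow> bpoly" where
  "act_bvar g v = (\<Sum>r\<in>UNIV. bconst (g $ r $ snd v) * bvar (fst v, r))"

definition act_fvar :: "complex^2^2 \<Rightarrow> var \<Rightarrow> superpoly" where
  "act_fvar g v = (\<Sum>r\<in>UNIV. super_mult (super_const (g $ r $ snd v)) (fvar (fst v, r)))"

definition act_bpoly :: "complex^2^2 \<Rightarrow> bpoly \<Rightarrow> bpoly" where
  "act_bpoly g f =
     (\<Sum>m\<in>Poly_Mapping.keys f. bconst (Poly_Mapping.lookup f m) *
        (\<Prod>v\<in>Poly_Mapping.keys m. act_bvar g v ^ Poly_Mapping.lookup m v))"

text \<open>The image of \<open>\<theta>\<^sub>F\<close>: the product of the images of its factors, in the same order.\<close>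

definition act_fmonom :: "complex^2^2 \<Rightarrow> var set \<Rightarrow> superpoly" where
  "act_fmonom g F =
     foldr (\<lambda>v q. super_mult (act_fvar g v) q) (sorted_key_list_of_set fpos F) (super_of_bpoly 1)"

definition super_act :: "complex^2^2 \<Rightarrow> superpoly \<Rightarrow> superpoly" where
  "super_act g p =
     (\<Sum>F\<in>Poly_Mapping.keys p.
        super_mult (super_of_bpoly (act_bpoly g (Poly_Mapping.lookup p F))) (act_fmonom g F))"


section \<open>The coinvariant ring\<close>

definition dihedral_invariants :: "nat \<Rightarrow> nat \<Rightarrow> nat \<Rightarrow> superpoly set" where
  "dihedral_invariants n k j =
     {p \<in> carrier (super_ring k j). \<forall>g\<in>dihedral_group n. super_act g p = p}"

definition coinvariant_ideal :: "nat \<Rightarrow> nat \<Rightarrow> nat \<Rightarrow> superpoly set" where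
  "coinvariant_ideal n k j =
     Idl\<^bsub>super_ring k j\<^esub> {p \<in> dihedral_invariants n k j. constant_term p = 0}"

definition coinvariant_ring :: "nat \<Rightarrow> nat \<Rightarrow> nat \<Rightarrow> superpoly set ring" where
  "coinvariant_ring n k j = super_ring k j Quot coinvariant_ideal n k j"

text \<open>
  The copy of \<open>\<complex>\<close> in the coinvariant ring, needed because \<open>ring.dimension\<close> measures
  dimension over a subset of the ring.
\<close>

definition coinvariant_scalars :: "nat \<Rightarrow> nat \<Rightarrow> nat \<Rightarrow> superpoly set set" where
  "coinvariant_scalars n k j =
     {coinvariant_ideal n k j +>\<^bsub>super_ring k j\<^esub> super_const c | c. c \<in> UNIV}"

text \<open>
  The number of monomials of degree \<open>m\<close> in \<open>k\<close> commuting variables. For \<open>k = m = 0\<close> the upper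
  entry is \<open>-1\<close> in the integers and truncates to \<open>0\<close> here; either way the value is 1.
\<close>

definition num_monomials :: "nat \<Rightarrow> nat \<Rightarrow> nat" where
  "num_monomials k m = (k + m - 1) choose m"

end

theory Submission
  imports Defs
begin

text \<open>
  Over the complex numbers the rotation is diagonalisable. The substitution \<open>eigenbasis\<close>, which
  sends the two variables \<open>v\<^sub>1, v\<^sub>2\<close> of each pair to \<open>v\<^sub>1 + i v\<^sub>2\<close> and \<open>v\<^sub>1 - i v\<^sub>2\<close>, is an
  automorphism of the superpolynomial ring. It turns the rotation into the action that multiplies
  variables with subscript 1 by \<open>\<zeta>\<^sup>-\<^sup>1\<close> and variables with subscript 2 by \<open>\<zeta>\<close>, where \<open>\<zeta>\<close> is a
  primitive \<open>n\<close>-th root of unity, and it turns the reflection into the exchange \<open>\<sigma>\<close> of the two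
  subscripts. The ring is bigraded by the numbers \<open>(a, b)\<close> of variables with subscript 1 and
  subscript 2 in a monomial, and after the substitution an invariant is a \<open>\<sigma>\<close>-fixed combination of
  monomials whose bidegree satisfies \<open>a \<equiv> b\<close> modulo \<open>n\<close>.

  The ideal \<open>I\<close> generated by the invariants without constant term can then be described degree by
  degree.

  \<^item> In bidegrees \<open>(a, 0)\<close> and \<open>(0, a)\<close> with \<open>a < n\<close> it is zero, as an invariant without constant
    term has no component there.
  \<^item> In the edge bidegrees \<open>(1, 1)\<close>, \<open>(n, 0)\<close> and \<open>(0, n)\<close> it consists of the \<open>\<sigma>\<close>-fixed elements.
  \<^item> In all other bidegrees it is everything. For a mixed monomial of total degree at least 3 this
    comes from three variables (\<open>mixed_triple_in_ideal\<close>): apart from the signs of anticommutation,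
    exchanging the superscripts of a mixed pair gives a minus sign modulo \<open>I\<close>, exchanging those of
    two variables with equal subscript does not, and both rules for three superscripts force the
    product to vanish. For a monomial in more
    than \<open>n\<close> variables of one subscript, the relation \<open>M + \<sigma> M \<in> I\<close> in degree \<open>n\<close> replaces \<open>n\<close>
    of the variables by those with the other subscript, which leaves a mixed monomial.

  Conversely, the space so described (\<open>eigen_kernel\<close>) is an ideal, since multiplication by an
  element of positive degree leads from the edge bidegrees and beyond only into the bidegrees of the
  third kind. Hence \<open>I\<close> is the common kernel of explicit linear functionals
  (\<open>mem_coinvariant_ideal_iff\<close>), and the dimension of the quotient is the number of these: the
  constant monomial, twice the monomials in \<open>i\<close> variables with subscript 1 for \<open>0 < i < n\<close>, once
  those for \<open>i = n\<close>, and one anti-invariant of bidegree \<open>(1, 1)\<close> for each pair of distinct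
  superscripts and for each fermionic superscript paired with itself.
\<close>

notation super_mult (infixl "\<star>" 70)

abbreviation pcoeff :: "('a \<Rightarrow>\<^sub>0 'b::zero) \<Rightarrow> 'a \<Rightarrow> 'b" where
  "pcoeff \<equiv> Poly_Mapping.lookup"

abbreviation psupp :: "('a \<Rightarrow>\<^sub>0 'b::zero) \<Rightarrow> 'a set" where
  "psupp \<equiv> Poly_Mapping.keys"

abbreviation psingle :: "'a \<Rightarrow> 'b::zero \<Rightarrow> ('a \<Rightarrow>\<^sub>0 'b)" where
  "psingle \<equiv> Poly_Mapping.single"

section \<open>Bilinearity and associativity of the product\<close>

lemma poly_mapping_eq_sum_single:
  fixes p :: "'a \<Rightarrow>\<^sub>0 'b::comm_monoid_add"
  assumes "finite A" "psupp p \<subseteq> A"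
  shows "p = (\<Sum>x\<in>A. psingle x (pcoeff p x))"
proof (rule poly_mapping_eqI)
  fix y
  have "pcoeff (\<Sum>x\<in>A. psingle x (pcoeff p x)) y = (\<Sum>x\<in>A. if x = y then pcoeff p x else 0)"
    by (simp add: lookup_sum lookup_single when_def cong: if_cong)
  also have "\<dots> = pcoeff p y"
    using assms by (auto simp: in_keys_iff)
  finally show "pcoeff p y = pcoeff (\<Sum>x\<in>A. psingle x (pcoeff p x)) y" by simp
qed

definition mult_term :: "superpoly \<Rightarrow> superpoly \<Rightarrow> var set \<Rightarrow> var set \<Rightarrow> superpoly" where
  "mult_term p q F G =
     (if F \<inter> G = {} then psingle (F \<union> G) (ferm_sign F G * pcoeff p F * pcoeff q G) else 0)"

text \<open>
  Summing over any finite sets that contain the supports makes the two factors of a sum comparable,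
  which gives additivity in each argument.
\<close>

lemma super_mult_over:
  assumes "finite A" "psupp p \<subseteq> A" "finite B" "psupp q \<subseteq> B"
  shows "p \<star> q = (\<Sum>F\<in>A. \<Sum>G\<in>B. mult_term p q F G)"
proof -
  have "p \<star> q = (\<Sum>F\<in>psupp p. \<Sum>G\<in>psupp q. mult_term p q F G)"
    by (simp add: super_mult_def mult_term_def)
  also have "\<dots> = (\<Sum>F\<in>psupp p. \<Sum>G\<in>B. mult_term p q F G)"
    using assms
    by (intro sum.cong sum.mono_neutral_left) (auto simp: mult_term_def in_keys_iff)
  also have "\<dots> = (\<Sum>F\<in>A. \<Sum>G\<in>B. mult_term p q F G)"
    using assms
    by (intro sum.mono_neutral_left) (auto simp: mult_term_def in_keys_iff intro!: sum.neutral)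
  finally show ?thesis .
qed

lemma super_mult_add_left: "(p + p') \<star> q = p \<star> q + p' \<star> q"
proof -
  let ?A = "psupp p \<union> psupp p'"
  have "(p + p') \<star> q = (\<Sum>F\<in>?A. \<Sum>G\<in>psupp q. mult_term (p + p') q F G)"
    using Poly_Mapping.keys_add[of p p'] by (intro super_mult_over) auto
  also have "\<dots> = (\<Sum>F\<in>?A. \<Sum>G\<in>psupp q. mult_term p q F G + mult_term p' q F G)"
    by (intro sum.cong refl) (simp add: mult_term_def lookup_add single_add algebra_simps)
  also have "\<dots> = p \<star> q + p' \<star> q"
    by (subst (1 2) super_mult_over[where A = ?A and B = "psupp q"]) (auto simp: sum.distrib)
  finally show ?thesis .
qed

lemma super_mult_add_right: "p \<star> (q + q') = p \<star> q + p \<star> q'"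
proof -
  let ?B = "psupp q \<union> psupp q'"
  have "p \<star> (q + q') = (\<Sum>F\<in>psupp p. \<Sum>G\<in>?B. mult_term p (q + q') F G)"
    using Poly_Mapping.keys_add[of q q'] by (intro super_mult_over) auto
  also have "\<dots> = (\<Sum>F\<in>psupp p. \<Sum>G\<in>?B. mult_term p q F G + mult_term p q' F G)"
    by (intro sum.cong refl) (simp add: mult_term_def lookup_add single_add algebra_simps)
  also have "\<dots> = p \<star> q + p \<star> q'"
    by (subst (1 2) super_mult_over[where A = "psupp p" and B = ?B]) (auto simp: sum.distrib)
  finally show ?thesis .
qed

lemma super_mult_zero [simp]: "0 \<star> q = 0" "p \<star> 0 = 0"
  by (simp_all add: super_mult_def)

lemma super_mult_minus_left: "(- p) \<star> q = - (p \<star> q)"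
  using super_mult_add_left[of p "- p" q] by (simp add: eq_neg_iff_add_eq_0 add.commute)

lemma super_mult_sum_left: "sum f A \<star> q = (\<Sum>x\<in>A. f x \<star> q)"
  by (induction A rule: infinite_finite_induct) (simp_all add: super_mult_add_left)

lemma super_mult_sum_right: "p \<star> sum f A = (\<Sum>x\<in>A. p \<star> f x)"
  by (induction A rule: infinite_finite_induct) (simp_all add: super_mult_add_right)

lemma super_mult_single:
  "psingle F a \<star> psingle G b =
     (if F \<inter> G = {} then psingle (F \<union> G) (ferm_sign F G * a * b) else 0)"
  by (subst super_mult_over[where A = "{F}" and B = "{G}"]) (auto simp: mult_term_def)

lemma ferm_sign_empty [simp]: "ferm_sign {} G = 1" "ferm_sign F {} = 1"
  by (simp_all add: ferm_sign_def)

text \<open>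
  The out-of-order pairs for a disjoint union are the disjoint union of the out-of-order pairs.
\<close>

lemma ferm_sign_union_left:
  assumes "finite F" "finite G" "finite H" "F \<inter> G = {}"
  shows "ferm_sign (F \<union> G) H = ferm_sign F H * ferm_sign G H"
proof -
  define S where "S A = {(u, v). u \<in> A \<and> v \<in> H \<and> fpos v < fpos u}" for A
  have "finite (S A)" if "finite A" for A
    by (rule finite_subset[of _ "A \<times> H"]) (use assms that in \<open>auto simp: S_def\<close>)
  moreover have "S (F \<union> G) = S F \<union> S G" "S F \<inter> S G = {}"
    using assms by (auto simp: S_def)
  ultimately have "card (S (F \<union> G)) = card (S F) + card (S G)"
    using assms by (simp add: card_Un_disjoint)
  thus ?thesis by (simp add: ferm_sign_def power_add S_def)
qed

lemma ferm_sign_union_right: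
  assumes "finite F" "finite G" "finite H" "G \<inter> H = {}"
  shows "ferm_sign F (G \<union> H) = ferm_sign F G * ferm_sign F H"
proof -
  define S where "S A = {(u, v). u \<in> F \<and> v \<in> A \<and> fpos v < fpos u}" for A
  have "finite (S A)" if "finite A" for A
    by (rule finite_subset[of _ "F \<times> A"]) (use assms that in \<open>auto simp: S_def\<close>)
  moreover have "S (G \<union> H) = S G \<union> S H" "S G \<inter> S H = {}"
    using assms by (auto simp: S_def)
  ultimately have "card (S (G \<union> H)) = card (S G) + card (S H)"
    using assms by (simp add: card_Un_disjoint)
  thus ?thesis by (simp add: ferm_sign_def power_add S_def)
qed

text \<open>
  The sign \<open>ferm_sign\<close> is \<open>1\<close> when infinitely many pairs are out of order, so signs multiply only
  over finite sets. Associativity is therefore confined to the superpolynomials all of whose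
  fermionic monomials are finite; these include every carrier.
\<close>

definition fin :: "superpoly \<Rightarrow> bool" where
  "fin p \<longleftrightarrow> (\<forall>F\<in>psupp p. finite F)"

lemma fin_zero [simp, intro]: "fin 0"
  by (simp add: fin_def)

lemma fin_single [simp]: "fin (psingle F a) \<longleftrightarrow> finite F \<or> a = 0"
  by (simp add: fin_def)

lemma fin_add [simp, intro]: "fin p \<Longrightarrow> fin q \<Longrightarrow> fin (p + q)"
  using Poly_Mapping.keys_add[of p q] by (auto simp: fin_def)

lemma fin_sum [intro]: "(\<And>x. x \<in> A \<Longrightarrow> fin (f x)) \<Longrightarrow> fin (sum f A)"
  by (induction A rule: infinite_finite_induct) auto

lemma fin_mult [simp, intro]: "fin p \<Longrightarrow> fin q \<Longrightarrow> fin (p \<star> q)"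
  unfolding super_mult_def by (intro fin_sum) (auto simp: fin_def)

lemma superpoly_single_induct:
  assumes "P 0" "\<And>p q. P p \<Longrightarrow> P q \<Longrightarrow> P (p + q)"
    and "\<And>F. F \<in> psupp p \<Longrightarrow> P (psingle F (pcoeff p F))"
  shows "P (p :: 'a \<Rightarrow>\<^sub>0 'b::comm_monoid_add)"
proof -
  have "P (\<Sum>F\<in>A. psingle F (pcoeff p F))" if "A \<subseteq> psupp p" for A
    using finite_subset[OF that finite_keys] that
    by (induction A rule: finite_induct) (use assms in auto)
  from this[of "psupp p"] show ?thesis
    using poly_mapping_eq_sum_single[of "psupp p" p] by simp
qed

text \<open>
  By additivity it suffices to multiply three monomials. Both bracketings then carry the sign that
  counts the out-of-order pairs of all three pairs of factors.
\<close>

lemma super_mult_assoc: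
  assumes "fin p" "fin q" "fin r"
  shows "p \<star> q \<star> r = p \<star> (q \<star> r)"
proof -
  have *: "psingle F a \<star> psingle G b \<star> psingle H c = psingle F a \<star> (psingle G b \<star> psingle H c)"
    if "finite F" "finite G" "finite H" for F G H a b c
    using that
    by (auto simp: super_mult_single ferm_sign_union_left ferm_sign_union_right Un_assoc
        Int_Un_distrib Int_Un_distrib2 ac_simps)
  have "psingle F a \<star> psingle G b \<star> r = psingle F a \<star> (psingle G b \<star> r)"
    if "finite F" "finite G" for F G a b
    by (rule superpoly_single_induct[where p = r])
       (use assms that in \<open>auto simp: super_mult_add_left super_mult_add_right fin_def intro!: *\<close>)
  hence "psingle F a \<star> q \<star> r = psingle F a \<star> (q \<star> r)"
    if "finite F" for F a
    by (rule superpoly_single_induct[where p = q, rotated 2])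
       (use assms that in \<open>auto simp: super_mult_add_left super_mult_add_right fin_def\<close>)
  thus ?thesis
    by (rule superpoly_single_induct[where p = p, rotated 2])
       (use assms in \<open>auto simp: super_mult_add_left super_mult_add_right fin_def\<close>)
qed

abbreviation sone :: superpoly where "sone \<equiv> super_of_bpoly 1"

lemma fin_of_bpoly [simp]: "fin (super_of_bpoly f)"
  by (simp add: super_of_bpoly_def)

lemma of_bpoly_mult_single: "super_of_bpoly f \<star> psingle G b = psingle G (f * b)"
  by (simp add: super_of_bpoly_def super_mult_single)

lemma single_mult_of_bpoly: "psingle G b \<star> super_of_bpoly f = psingle G (f * b)"
  by (simp add: super_of_bpoly_def super_mult_single mult.commute)

lemma of_bpoly_central: "super_of_bpoly f \<star> p = p \<star> super_of_bpoly f"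
  by (rule superpoly_single_induct[where p = p])
     (auto simp: super_mult_add_left super_mult_add_right of_bpoly_mult_single single_mult_of_bpoly)

lemma sone_mult [simp]: "sone \<star> p = p" "p \<star> sone = p"
proof -
  show "sone \<star> p = p"
    by (rule superpoly_single_induct[where p = p])
       (auto simp: super_mult_add_right of_bpoly_mult_single)
  thus "p \<star> sone = p" by (simp add: of_bpoly_central)
qed

lemma of_bpoly_mult: "super_of_bpoly (f * g) = super_of_bpoly f \<star> super_of_bpoly g"
  by (simp add: super_of_bpoly_def super_mult_single)

lemma of_bpoly_add: "super_of_bpoly (f + g) = super_of_bpoly f + super_of_bpoly g"
  by (simp add: super_of_bpoly_def single_add)

section \<open>Scalars, monomials and coefficients\<close>

type_synonym mon = "(var \<Rightarrow>\<^sub>0 nat) \<times> var set"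

definition scl :: "complex \<Rightarrow> superpoly \<Rightarrow> superpoly" where
  "scl c p = super_const c \<star> p"

definition coef :: "superpoly \<Rightarrow> mon \<Rightarrow> complex" where
  "coef p M = pcoeff (pcoeff p (snd M)) (fst M)"

definition smonom :: "mon \<Rightarrow> superpoly" where
  "smonom M = psingle (snd M) (psingle (fst M) 1)"

lemma superpoly_eqI: "(\<And>M. coef p M = coef q M) \<Longrightarrow> p = q"
  by (intro poly_mapping_eqI) (metis coef_def fst_conv snd_conv)

lemma coef_simps [simp]:
  "coef 0 M = 0" "coef (p + q) M = coef p M + coef q M"
  "coef (- p) M = - coef p M" "coef (p - q) M = coef p M - coef q M"
  by (simp_all add: coef_def lookup_add lookup_minus)

lemma coef_sum: "coef (sum f A) M = (\<Sum>x\<in>A. coef (f x) M)"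
  by (induction A rule: infinite_finite_induct) simp_all

lemma coef_smonom: "coef (smonom M) M' = (if M = M' then 1 else 0)"
  by (auto simp: coef_def smonom_def lookup_single when_def prod_eq_iff)

lemma pcoeff_bconst_mult: "pcoeff (bconst c * f) m = c * pcoeff f m"
proof (rule superpoly_single_induct[where p = f])
  fix l show "pcoeff (bconst c * psingle l (pcoeff f l)) m = c * pcoeff (psingle l (pcoeff f l)) m"
    by (simp add: bconst_def mult_single lookup_single when_def)
qed (simp_all add: algebra_simps lookup_add)

lemma coef_scl [simp]: "coef (scl c p) M = c * coef p M"
proof (rule superpoly_single_induct[where p = p])
  fix F show "coef (scl c (psingle F (pcoeff p F))) M = c * coef (psingle F (pcoeff p F)) M"
    by (simp add: scl_def super_const_def of_bpoly_mult_single coef_def lookup_single when_def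
        pcoeff_bconst_mult)
qed (simp_all add: scl_def super_mult_add_right algebra_simps)

lemma scl_simps [simp]:
  "scl c 0 = 0" "scl 0 p = 0" "scl 1 p = p" "scl c (scl d p) = scl (c * d) p"
  by (intro superpoly_eqI; simp)+

lemma scl_minus: "scl c (- p) = - scl c p" "scl (- c) p = - scl c p"
  by (intro superpoly_eqI; simp)+

lemma scl_add: "scl c (p + q) = scl c p + scl c q" "scl (c + d) p = scl c p + scl d p"
  by (intro superpoly_eqI; simp add: algebra_simps)+

lemma scl_sum: "scl c (sum f A) = (\<Sum>x\<in>A. scl c (f x))"
  by (induction A rule: infinite_finite_induct) (simp_all add: scl_add)

lemma fin_const [simp]: "fin (super_const c)"
  by (simp add: super_const_def)

lemma fin_scl [simp, intro]: "fin p \<Longrightarrow> fin (scl c p)"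
  by (simp add: scl_def)

lemma scl_mult_left: "scl c p \<star> q = scl c (p \<star> q)"
proof -
  have *: "scl c (psingle F a) = psingle F (bconst c * a)" for F a
    by (simp add: scl_def super_const_def of_bpoly_mult_single)
  have "scl c (psingle F a) \<star> q = scl c (psingle F a \<star> q)" for F a
    by (rule superpoly_single_induct[where p = q])
       (auto simp: super_mult_add_right scl_add * super_mult_single ac_simps)
  thus ?thesis
    by - (rule superpoly_single_induct[where p = p], auto simp: super_mult_add_left scl_add)
qed

lemma scl_mult_right: "p \<star> scl c q = scl c (p \<star> q)"
proof -
  have *: "scl c (psingle F a) = psingle F (bconst c * a)" for F a
    by (simp add: scl_def super_const_def of_bpoly_mult_single)
  have "psingle F a \<star> scl c q = scl c (psingle F a \<star> q)" for F a
    by (rule superpoly_single_induct[where p = q])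
       (auto simp: super_mult_add_right scl_add * super_mult_single ac_simps)
  thus ?thesis
    by - (rule superpoly_single_induct[where p = p], auto simp: super_mult_add_left scl_add)
qed

lemma super_const_eq_scl: "super_const c = scl c sone"
  by (simp add: scl_def)

definition supp :: "superpoly \<Rightarrow> mon set" where
  "supp p = {M. coef p M \<noteq> 0}"

lemma supp_eq: "supp p = (\<Union>F\<in>psupp p. (\<lambda>m. (m, F)) ` psupp (pcoeff p F))"
  by (auto simp: supp_def coef_def in_keys_iff image_iff)

lemma finite_supp [simp]: "finite (supp p)"
  by (simp add: supp_eq)

lemma superpoly_eq_sum_smonom: "p = (\<Sum>M\<in>supp p. scl (coef p M) (smonom M))"
proof (rule superpoly_eqI)
  fix M
  have "coef (\<Sum>M\<in>supp p. scl (coef p M) (smonom M)) M = (\<Sum>M'\<in>supp p. if M' = M then coef p M' else 0)"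
    by (simp add: coef_sum coef_smonom if_distrib cong: if_cong)
  also have "\<dots> = coef p M"
    by (simp add: sum.delta) (simp add: supp_def)
  finally show "coef p M = coef (\<Sum>M\<in>supp p. scl (coef p M) (smonom M)) M" by simp
qed

text \<open>
  Linear properties need only be checked on multiples of monomials of the support.
\<close>

lemma superpoly_smonom_induct:
  assumes "P 0" "\<And>p q. P p \<Longrightarrow> P q \<Longrightarrow> P (p + q)" "\<And>c M. M \<in> supp p \<Longrightarrow> P (scl c (smonom M))"
  shows "P p"
proof -
  have "P (\<Sum>M\<in>A. scl (coef p M) (smonom M))" if "A \<subseteq> supp p" for A
    using finite_subset[OF that finite_supp] that
    by (induction A rule: finite_induct) (use assms in auto)
  from this[of "supp p"] show ?thesis
    using superpoly_eq_sum_smonom[of p] by simp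
qed

lemma fin_iff_supp: "fin p \<longleftrightarrow> (\<forall>M\<in>supp p. finite (snd M))"
proof -
  have "\<exists>m. m \<in> psupp (pcoeff p F)" if "F \<in> psupp p" for F
    using that by (metis all_not_in_conv in_keys_iff keys_eq_empty)
  thus ?thesis by (fastforce simp: fin_def supp_eq)
qed

section \<open>The action is an algebra homomorphism\<close>

definition act_exponent :: "complex^2^2 \<Rightarrow> (var \<Rightarrow>\<^sub>0 nat) \<Rightarrow> bpoly" where
  "act_exponent g m = (\<Prod>v\<in>psupp m. act_bvar g v ^ pcoeff m v)"

lemma act_exponent_over:
  assumes "finite A" "psupp m \<subseteq> A"
  shows "act_exponent g m = (\<Prod>v\<in>A. act_bvar g v ^ pcoeff m v)"
  unfolding act_exponent_def using assms
  by (intro prod.mono_neutral_left) (auto simp: in_keys_iff)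

lemma act_exponent_add: "act_exponent g (m + m') = act_exponent g m * act_exponent g m'"
proof -
  let ?A = "psupp m \<union> psupp m'"
  have "act_exponent g (m + m') = (\<Prod>v\<in>?A. act_bvar g v ^ pcoeff (m + m') v)"
    using Poly_Mapping.keys_add[of m m'] by (intro act_exponent_over) auto
  also have "\<dots> = act_exponent g m * act_exponent g m'"
    by (subst (1 2) act_exponent_over[where A = ?A])
       (auto simp: lookup_add power_add prod.distrib)
  finally show ?thesis .
qed

lemma act_exponent_single [simp]: "act_exponent g (psingle v 1) = act_bvar g v"
  by (simp add: act_exponent_def)

lemma act_exponent_zero [simp]: "act_exponent g 0 = 1"
  by (simp add: act_exponent_def)

lemma act_bpoly_over:
  assumes "finite A" "psupp f \<subseteq> A"
  shows "act_bpoly g f = (\<Sum>m\<in>A. bconst (pcoeff f m) * act_exponent g m)"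
  unfolding act_bpoly_def act_exponent_def[symmetric] using assms
  by (intro sum.mono_neutral_left) (auto simp: in_keys_iff bconst_def)

lemma bconst_add: "bconst (c + d) = bconst c + bconst d"
  by (simp add: bconst_def single_add)

lemma bconst_mult: "bconst (c * d) = bconst c * bconst d"
  by (simp add: bconst_def mult_single)

lemma act_bpoly_add: "act_bpoly g (f + h) = act_bpoly g f + act_bpoly g h"
proof -
  let ?A = "psupp f \<union> psupp h"
  have "act_bpoly g (f + h) = (\<Sum>m\<in>?A. bconst (pcoeff (f + h) m) * act_exponent g m)"
    using Poly_Mapping.keys_add[of f h] by (intro act_bpoly_over) auto
  also have "\<dots> = act_bpoly g f + act_bpoly g h"
    by (subst (1 2) act_bpoly_over[where A = ?A])
       (auto simp: lookup_add bconst_add algebra_simps sum.distrib)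
  finally show ?thesis .
qed

lemma act_bpoly_zero [simp]: "act_bpoly g 0 = 0"
  by (simp add: act_bpoly_def)

lemma act_bpoly_single: "act_bpoly g (psingle m c) = bconst c * act_exponent g m"
  by (subst act_bpoly_over[where A = "{m}"]) auto

lemma act_bpoly_one [simp]: "act_bpoly g 1 = 1"
  using act_bpoly_single[of g 0 1] by (simp add: bconst_def)

lemma act_bpoly_mult: "act_bpoly g (f * h) = act_bpoly g f * act_bpoly g h"
proof -
  have "act_bpoly g (psingle m c * h) = act_bpoly g (psingle m c) * act_bpoly g h" for m c
    by (rule superpoly_single_induct[where p = h])
       (simp_all add: algebra_simps act_bpoly_add mult_single act_bpoly_single bconst_mult
          act_exponent_add)
  thus ?thesis
    by - (rule superpoly_single_induct[where p = f], simp_all add: distrib_right act_bpoly_add)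
qed

lemma act_bpoly_bvar: "act_bpoly g (bvar v) = act_bvar g v"
  unfolding bvar_def act_bpoly_single act_exponent_single by (simp add: bconst_def)

lemma act_bpoly_bconst: "act_bpoly g (bconst c) = bconst c"
  by (simp add: bconst_def act_bpoly_single)

lemma super_act_over:
  assumes "finite A" "psupp p \<subseteq> A"
  shows "super_act g p = (\<Sum>F\<in>A. super_of_bpoly (act_bpoly g (pcoeff p F)) \<star> act_fmonom g F)"
  unfolding super_act_def using assms
  by (intro sum.mono_neutral_left) (auto simp: in_keys_iff super_of_bpoly_def)

lemma super_act_add: "super_act g (p + q) = super_act g p + super_act g q"
proof -
  let ?A = "psupp p \<union> psupp q"
  have "super_act g (p + q)
      = (\<Sum>F\<in>?A. super_of_bpoly (act_bpoly g (pcoeff (p + q) F)) \<star> act_fmonom g F)"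
    using Poly_Mapping.keys_add[of p q] by (intro super_act_over) auto
  also have "\<dots> = super_act g p + super_act g q"
    by (subst (1 2) super_act_over[where A = ?A])
       (auto simp: lookup_add act_bpoly_add of_bpoly_add super_mult_add_left sum.distrib)
  finally show ?thesis .
qed

lemma super_act_zero [simp]: "super_act g 0 = 0"
  by (simp add: super_act_def)

lemma super_act_single:
  "super_act g (psingle F a) = super_of_bpoly (act_bpoly g a) \<star> act_fmonom g F"
  by (subst super_act_over[where A = "{F}"]) auto

lemma fin_fvar [simp]: "fin (fvar v)"
  by (simp add: fvar_def)

lemma act_fvar_eq: "act_fvar g v = (\<Sum>r\<in>UNIV. scl (g $ r $ snd v) (fvar (fst v, r)))"
  by (simp add: act_fvar_def scl_def)

lemma fin_act_fvar [simp]: "fin (act_fvar g v)"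
  unfolding act_fvar_eq by (intro fin_sum) auto

lemma fin_foldr_mult: "(\<And>x. fin (f x)) \<Longrightarrow> fin (foldr (\<lambda>x q. f x \<star> q) xs sone)"
  by (induction xs) auto

lemma fin_act_fmonom [simp]: "fin (act_fmonom g F)"
  unfolding act_fmonom_def by (rule fin_foldr_mult) simp

lemma super_act_of_bpoly_mult:
  "super_act g (super_of_bpoly a \<star> p) = super_of_bpoly (act_bpoly g a) \<star> super_act g p"
  by (rule superpoly_single_induct[where p = p])
     (simp_all add: super_mult_add_right super_act_add of_bpoly_mult_single super_act_single
        act_bpoly_mult of_bpoly_mult super_mult_assoc)

lemma super_act_scl: "super_act g (scl c p) = scl c (super_act g p)"
  by (simp add: scl_def super_const_def super_act_of_bpoly_mult act_bpoly_bconst)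

lemma super_act_minus: "super_act g (- p) = - super_act g p"
  using super_act_scl[of g "-1" p] by (simp add: scl_minus)

lemma super_act_diff: "super_act g (p - q) = super_act g p - super_act g q"
  using super_act_add[of g p "- q"] by (simp add: super_act_minus)

lemma super_act_sum: "super_act g (sum f A) = (\<Sum>x\<in>A. super_act g (f x))"
  by (induction A rule: infinite_finite_induct) (simp_all add: super_act_add)

lemma inj_fpos: "inj fpos"
proof (rule injI)
  fix u v :: var
  assume eq: "fpos u = fpos v"
  define e :: "2 \<Rightarrow> nat" where "e r = (if r = 1 then 0 else 1)" for r
  have *: "2 * fst u + e (snd u) = 2 * fst v + e (snd v)"
    using eq by (simp only: fpos_def e_def)
  have less: "e r < 2" for r by (simp add: e_def)
  have "fst u = (2 * fst u + e (snd u)) div 2" "e (snd u) = (2 * fst u + e (snd u)) mod 2"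
    using less[of "snd u"] by simp_all
  moreover have "fst v = (2 * fst v + e (snd v)) div 2" "e (snd v) = (2 * fst v + e (snd v)) mod 2"
    using less[of "snd v"] by simp_all
  ultimately have "fst u = fst v" and "e (snd u) = e (snd v)"
    unfolding * by simp_all
  moreover from this(2) have "snd u = 1 \<longleftrightarrow> snd v = 1"
    by (simp only: e_def split: if_splits)
  ultimately show "u = v"
    using exhaust_2[of "snd u"] exhaust_2[of "snd v"] by (metis prod_eq_iff)
qed

lemma (in linorder) sorted_key_list_of_set_inj:
  assumes "inj f" "finite A"
  shows "sorted (map f (sorted_key_list_of_set f A))"
    and "distinct (sorted_key_list_of_set f A)"
    and "set (sorted_key_list_of_set f A) = A"
    and "x \<notin> A \<Longrightarrow> sorted_key_list_of_set f (insert x A) = insort_key f x (sorted_key_list_of_set f A)"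
    and "sorted_key_list_of_set f {} = []"
proof -
  interpret folding_insort_key "(\<le>)" "(<)" UNIV f
    by standard (rule assms(1))
  show "sorted (map f (sorted_key_list_of_set f A))"
    by (rule sorted_sorted_key_list_of_set) simp
  show "set (sorted_key_list_of_set f A) = A"
    by (rule set_sorted_key_list_of_set) (simp_all add: assms)
  show "x \<notin> A \<Longrightarrow> sorted_key_list_of_set f (insert x A) = insort_key f x (sorted_key_list_of_set f A)"
    by (rule sorted_key_list_of_set_insert) (simp_all add: assms)
  show "sorted_key_list_of_set f {} = []"
    by (rule sorted_key_list_of_set_empty)
  show "distinct (sorted_key_list_of_set f A)"
    using distinct_sorted_key_list_of_set[OF subset_UNIV, of A] unfolding distinct_map ..
qed

lemma superpoly_eq_neg_self:
  assumes "(p :: superpoly) = - p"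
  shows "p = 0"
proof (rule superpoly_eqI)
  fix M
  have "coef p M = coef (- p) M" by (rule arg_cong[OF assms])
  thus "coef p M = coef 0 M" by simp
qed

text \<open>
  The out-of-order pairs of \<open>{v}\<close> and \<open>F\<close> correspond to the elements of \<open>F\<close> below \<open>v\<close>.
\<close>

lemma fvar_mult_single:
  "fvar v \<star> psingle F a =
     (if v \<in> F then 0 else psingle (insert v F) ((-1) ^ card {w \<in> F. fpos w < fpos v} * a))"
proof -
  have "{(u, w). u \<in> {v} \<and> w \<in> F \<and> fpos w < fpos u} = Pair v ` {w \<in> F. fpos w < fpos v}"
    by auto
  hence "ferm_sign {v} F = (-1) ^ card {w \<in> F. fpos w < fpos v}"
    by (simp add: ferm_sign_def card_image inj_on_def)
  thus ?thesis by (simp add: fvar_def super_mult_single)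
qed

lemma fvar_anticomm: "fvar u \<star> fvar v = - (fvar v \<star> fvar u)"
proof (cases "u = v")
  case True
  thus ?thesis by (simp add: fvar_def super_mult_single)
next
  case False
  hence "fpos u \<noteq> fpos v" using inj_fpos by (auto dest: injD)
  hence "{w \<in> {v}. fpos w < fpos u} = (if fpos v < fpos u then {v} else {})"
    "{w \<in> {u}. fpos w < fpos v} = (if fpos v < fpos u then {} else {u})" by auto
  thus ?thesis
    using False by (subst (2 4) fvar_def)
      (auto simp: fvar_mult_single insert_commute single_uminus)
qed

lemma act_fvar_mult_act_fvar:
  "act_fvar g u \<star> act_fvar g v = (\<Sum>r\<in>UNIV. \<Sum>s\<in>UNIV.
      scl (g $ r $ snd u * g $ s $ snd v) (fvar (fst u, r) \<star> fvar (fst v, s)))"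
  unfolding act_fvar_eq super_mult_sum_left
  unfolding super_mult_sum_right
  by (simp add: scl_mult_left scl_mult_right mult.commute)

text \<open>
  Anticommutation is bilinear, so it passes from the variables to their linear combinations.
\<close>

lemma act_fvar_anticomm: "act_fvar g u \<star> act_fvar g v = - (act_fvar g v \<star> act_fvar g u)"
proof -
  have "act_fvar g u \<star> act_fvar g v = (\<Sum>r\<in>UNIV. \<Sum>s\<in>UNIV.
      - scl (g $ s $ snd v * g $ r $ snd u) (fvar (fst v, s) \<star> fvar (fst u, r)))"
    unfolding act_fvar_mult_act_fvar
    by (intro sum.cong refl) (subst fvar_anticomm, simp add: scl_minus mult.commute)
  also have "\<dots> = - (act_fvar g v \<star> act_fvar g u)"
    unfolding act_fvar_mult_act_fvar by (subst sum.swap) (simp add: sum_negf)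
  finally show ?thesis .
qed

lemma act_fvar_square: "act_fvar g v \<star> act_fvar g v = 0"
  by (rule superpoly_eq_neg_self) (rule act_fvar_anticomm)

text \<open>
  Moving a new factor to its place in a sorted product costs one sign for each smaller factor,
  which is also the sign that the product of the superpolynomial ring prescribes.
\<close>

lemma act_fvar_mult_foldr:
  assumes "sorted (map fpos xs)" "distinct xs"
  shows "act_fvar g v \<star> foldr (\<lambda>v q. act_fvar g v \<star> q) xs sone =
    (if v \<in> set xs then 0 else scl ((-1) ^ card {w \<in> set xs. fpos w < fpos v})
       (foldr (\<lambda>v q. act_fvar g v \<star> q) (insort_key fpos v xs) sone))"
  using assms
proof (induction xs)
  case Nil
  thus ?case by simp
next
  case (Cons u xs)
  let ?E = "\<lambda>xs. foldr (\<lambda>v q. act_fvar g v \<star> q) xs sone"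
  have fin: "fin (?E xs)" for xs by (rule fin_foldr_mult) simp
  have sorted: "sorted (map fpos xs)" "\<forall>w\<in>set xs. fpos u \<le> fpos w" "u \<notin> set xs" "distinct xs"
    using Cons.prems by auto
  consider "u = v" | "u \<noteq> v" "fpos v \<le> fpos u" | "u \<noteq> v" "\<not> fpos v \<le> fpos u" by blast
  thus ?case
  proof cases
    case 1
    have "act_fvar g v \<star> ?E (u # xs) = (act_fvar g v \<star> act_fvar g v) \<star> ?E xs"
      using 1 fin by (simp add: super_mult_assoc)
    thus ?thesis using 1 by (simp add: act_fvar_square)
  next
    case 2
    hence "fpos v < fpos u" using inj_fpos by (metis injD le_neq_implies_less)
    hence less: "fpos v < fpos w" if "w \<in> set (u # xs)" for w
      using that sorted(2) by auto
    hence none: "{w \<in> set (u # xs). fpos w < fpos v} = {}" using less by (metis (mono_tags, lifting) empty_Collect_eq less_asym)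
    have "v \<notin> set (u # xs)" using less by blast
    thus ?thesis using 2 unfolding none by simp
  next
    case 3
    have "act_fvar g v \<star> ?E (u # xs) = (act_fvar g v \<star> act_fvar g u) \<star> ?E xs"
      using fin by (simp add: super_mult_assoc)
    also have "\<dots> = - (act_fvar g u \<star> (act_fvar g v \<star> ?E xs))"
      using fin by (subst act_fvar_anticomm) (simp add: super_mult_minus_left super_mult_assoc)
    also have "\<dots> = (if v \<in> set (u # xs) then 0
        else scl (- ((-1) ^ card {w \<in> set xs. fpos w < fpos v})) (?E (insort_key fpos v (u # xs))))"
      using 3 by (subst Cons.IH) (use sorted in \<open>auto simp: scl_mult_right scl_minus\<close>)
    also have "- ((-1) ^ card {w \<in> set xs. fpos w < fpos v}) =
        ((-1) ^ card {w \<in> set (u # xs). fpos w < fpos v} :: complex)"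
    proof -
      have "{w \<in> set (u # xs). fpos w < fpos v} = insert u {w \<in> set xs. fpos w < fpos v}"
        using 3 by auto
      thus ?thesis using sorted by simp
    qed
    finally show ?thesis .
  qed
qed

lemma act_fvar_mult_act_fmonom:
  assumes "finite F"
  shows "act_fvar g v \<star> act_fmonom g F = (if v \<in> F then 0
    else scl ((-1) ^ card {w \<in> F. fpos w < fpos v}) (act_fmonom g (insert v F)))"
  unfolding act_fmonom_def using sorted_key_list_of_set_inj[OF inj_fpos assms]
  by (subst act_fvar_mult_foldr) (auto simp: insert_absorb)

lemma of_bpoly_sign: "super_of_bpoly ((-1) ^ n) \<star> p = scl ((-1) ^ n) p"
proof -
  have "(-1) ^ n = bconst ((-1) ^ n)"
    by (cases "even n") (auto simp: bconst_def single_uminus)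
  thus ?thesis by (simp add: scl_def super_const_def)
qed

text \<open>
  Multiplicativity for one fermionic factor. Together with \<open>super_act_of_bpoly_mult\<close> it reduces every
  statement about the action on products to words in the variables.
\<close>

lemma super_act_fvar_mult:
  assumes "fin p"
  shows "super_act g (fvar v \<star> p) = act_fvar g v \<star> super_act g p"
proof (rule superpoly_single_induct[where p = p])
  fix F assume "F \<in> psupp p"
  hence F: "finite F" using assms by (simp add: fin_def)
  let ?a = "super_of_bpoly (act_bpoly g (pcoeff p F))"
  let ?s = "(-1) ^ card {w \<in> F. fpos w < fpos v}"
  have s: "act_bpoly g ((-1) ^ n) = (-1) ^ n" for n
  proof -
    have "act_bpoly g (-1) = -1"
      using act_bpoly_bconst[of g "-1"] by (simp add: bconst_def single_uminus)
    thus ?thesis by (induction n) (simp_all only: power.simps act_bpoly_one act_bpoly_mult)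
  qed
  have "act_fvar g v \<star> super_act g (psingle F (pcoeff p F)) = ?a \<star> (act_fvar g v \<star> act_fmonom g F)"
    by (simp add: super_act_single super_mult_assoc[symmetric] of_bpoly_central)
  also have "\<dots> = super_act g (fvar v \<star> psingle F (pcoeff p F))"
    using F by (auto simp: act_fvar_mult_act_fmonom fvar_mult_single super_act_single act_bpoly_mult
        of_bpoly_mult of_bpoly_sign s scl_mult_left scl_mult_right super_mult_assoc)
  finally show "super_act g (fvar v \<star> psingle F (pcoeff p F))
      = act_fvar g v \<star> super_act g (psingle F (pcoeff p F))" ..
qed (simp_all add: super_mult_add_right super_act_add)

lemma super_act_sone [simp]: "super_act g sone = sone"
proof -
  have "act_fmonom g {} = sone"
    using sorted_key_list_of_set_inj(5)[OF inj_fpos finite.emptyI] by (simp add: act_fmonom_def)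
  thus ?thesis
    by (subst super_of_bpoly_def) (simp add: super_act_single)
qed

lemma fin_super_act [simp]: "fin (super_act g p)"
  unfolding super_act_def by (intro fin_sum) simp

section \<open>Words in the generators\<close>

text \<open>
  A variable is a letter: its colour is the superscript, \<open>Inl\<close> for bosonic and \<open>Inr\<close> for fermionic
  variables, and its second component is the subscript. Matrices change subscripts only, and the
  commutation sign of two letters depends on the colours only.
\<close>

type_synonym colour = "nat + nat"
type_synonym letter = "colour \<times> 2"

fun gvar :: "letter \<Rightarrow> superpoly" where
  "gvar (Inl a, r) = super_of_bpoly (bvar (a, r))"
| "gvar (Inr b, r) = fvar (b, r)"

lemma fin_gvar [simp]: "fin (gvar x)"
  by (cases x rule: gvar.cases) simp_all

lemma super_act_fvar: "super_act g (fvar v) = act_fvar g v"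
  using super_act_fvar_mult[of sone g v] by simp

lemma of_bpoly_sum: "super_of_bpoly (sum f A) = (\<Sum>x\<in>A. super_of_bpoly (f x))"
  by (induction A rule: infinite_finite_induct) (simp_all add: of_bpoly_add, simp_all add: super_of_bpoly_def)

lemma super_act_gvar: "super_act g (gvar (c, s)) = (\<Sum>r\<in>UNIV. scl (g $ r $ s) (gvar (c, r)))"
proof (cases c)
  case (Inl a)
  have "super_act g (super_of_bpoly (bvar (a, s)) \<star> sone) = super_of_bpoly (act_bvar g (a, s))"
    unfolding super_act_of_bpoly_mult by (simp add: act_bpoly_bvar)
  thus ?thesis
    by (simp add: Inl act_bvar_def of_bpoly_sum of_bpoly_mult scl_def super_const_def)
next
  case (Inr b)
  thus ?thesis by (simp add: super_act_fvar act_fvar_eq)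
qed

lemma super_act_gvar_mult:
  assumes "fin p"
  shows "super_act g (gvar x \<star> p) = super_act g (gvar x) \<star> super_act g p"
proof (cases x rule: gvar.cases)
  case (1 a r)
  have "super_act g (super_of_bpoly (bvar (a, r)) \<star> sone) = super_of_bpoly (act_bpoly g (bvar (a, r)))"
    unfolding super_act_of_bpoly_mult by simp
  thus ?thesis using 1 by (simp add: super_act_of_bpoly_mult)
next
  case (2 b r)
  thus ?thesis using assms by (simp add: super_act_fvar super_act_fvar_mult)
qed

definition word :: "letter list \<Rightarrow> superpoly" where
  "word ws = foldr (\<lambda>x q. gvar x \<star> q) ws sone"

lemma word_simps [simp]: "word [] = sone" "word (x # ws) = gvar x \<star> word ws"
  by (simp_all add: word_def)

lemma fin_word [simp]: "fin (word ws)"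
  by (induction ws) auto

lemma word_append: "word (us @ ws) = word us \<star> word ws"
  by (induction us) (simp_all add: super_mult_assoc)

definition comm_sign :: "colour \<Rightarrow> colour \<Rightarrow> complex" where
  "comm_sign c d = (if isl c \<or> isl d then 1 else -1)"

lemma comm_sign_commute: "comm_sign c d = comm_sign d c"
  by (simp add: comm_sign_def disj_commute)

lemma gvar_commute: "gvar x \<star> gvar y = scl (comm_sign (fst x) (fst y)) (gvar y \<star> gvar x)"
proof -
  consider a r where "x = (Inl a, r)" | a r where "y = (Inl a, r)"
    | b r d s where "x = (Inr b, r)" "y = (Inr d, s)"
    by (metis gvar.cases)
  thus ?thesis
  proof cases
    case 1
    thus ?thesis by (simp add: comm_sign_def) (rule of_bpoly_central)
  next
    case 2
    thus ?thesis by (simp add: comm_sign_def) (rule of_bpoly_central[symmetric])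
  next
    case 3
    thus ?thesis by (simp add: comm_sign_def scl_minus) (rule fvar_anticomm)
  qed
qed

definition letters :: "mon \<Rightarrow> letter set" where
  "letters M = (\<lambda>(a, r). (Inl a, r)) ` psupp (fst M) \<union> (\<lambda>(b, r). (Inr b, r)) ` snd M"

definition exp_degree :: "2 \<Rightarrow> (var \<Rightarrow>\<^sub>0 nat) \<Rightarrow> nat" where
  "exp_degree s m = (\<Sum>v\<in>psupp m. if snd v = s then pcoeff m v else 0)"

definition degree_in :: "2 \<Rightarrow> mon \<Rightarrow> nat" where
  "degree_in s M = exp_degree s (fst M) + card {v \<in> snd M. snd v = s}"

lemma exp_degree_over:
  assumes "finite A" "psupp m \<subseteq> A"
  shows "exp_degree s m = (\<Sum>v\<in>A. if snd v = s then pcoeff m v else 0)"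
  unfolding exp_degree_def using assms
  by (intro sum.mono_neutral_left) (auto simp: in_keys_iff)

lemma exp_degree_add: "exp_degree s (m + m') = exp_degree s m + exp_degree s m'"
proof -
  let ?A = "psupp m \<union> psupp m'"
  have "exp_degree s (m + m') = (\<Sum>v\<in>?A. if snd v = s then pcoeff (m + m') v else 0)"
    using Poly_Mapping.keys_add[of m m'] by (intro exp_degree_over) auto
  also have "\<dots> = exp_degree s m + exp_degree s m'"
    by (subst (1 2) exp_degree_over[where A = ?A])
       (auto simp: lookup_add sum.distrib[symmetric] intro!: sum.cong)
  finally show ?thesis .
qed

lemma exp_degree_single: "exp_degree s (psingle v n) = (if snd v = s then n else 0)"
  by (subst exp_degree_over[where A = "{v}"]) auto

lemma exp_degree_zero [simp]: "exp_degree s 0 = 0"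
  by (simp add: exp_degree_def)

lemma degree_in_mult:
  assumes "finite F" "finite G" "F \<inter> G = {}"
  shows "degree_in s (m + m', F \<union> G) = degree_in s (m, F) + degree_in s (m', G)"
proof -
  have "{v \<in> F \<union> G. snd v = s} = {v \<in> F. snd v = s} \<union> {v \<in> G. snd v = s}" by auto
  moreover have "card \<dots> = card {v \<in> F. snd v = s} + card {v \<in> G. snd v = s}"
    using assms by (intro card_Un_disjoint) auto
  ultimately show ?thesis by (simp add: degree_in_def exp_degree_add)
qed

text \<open>
  The monomial that a word spells up to sign. A repeated fermionic letter is counted once here,
  whereas the word itself is then zero.
\<close>

fun content :: "letter list \<Rightarrow> mon" where
  "content [] = (0, {})"
| "content ((Inl a, r) # ws) = (psingle (a, r) 1 + fst (content ws), snd (content ws))"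
| "content ((Inr b, r) # ws) = (fst (content ws), insert (b, r) (snd (content ws)))"

text \<open>
  Words without repeated fermionic letters, which are plus or minus a monomial.
\<close>

fun proper :: "letter list \<Rightarrow> bool" where
  "proper [] \<longleftrightarrow> True"
| "proper ((Inl a, r) # ws) \<longleftrightarrow> proper ws"
| "proper ((Inr b, r) # ws) \<longleftrightarrow> (b, r) \<notin> snd (content ws) \<and> proper ws"

lemma finite_content [simp]: "finite (snd (content ws))"
  by (induction ws rule: content.induct) simp_all

lemma smonom_one: "smonom (0, {}) = sone"
  by (simp add: smonom_def super_of_bpoly_def)

lemma boson_mult_smonom: "super_of_bpoly (bvar v) \<star> smonom (m, F) = smonom (psingle v 1 + m, F)"
  by (simp add: smonom_def of_bpoly_mult_single bvar_def mult_single)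

lemma scl_single: "scl c (psingle F a) = psingle F (bconst c * a)"
  by (simp add: scl_def super_const_def of_bpoly_mult_single)

lemma bconst_sign: "bconst ((-1) ^ n) = (-1) ^ n"
  by (cases "even n") (auto simp: bconst_def single_uminus)

lemma fermion_mult_smonom:
  "fvar v \<star> smonom (m, F) = (if v \<in> F then 0
     else scl ((-1) ^ card {w \<in> F. fpos w < fpos v}) (smonom (m, insert v F)))"
  by (simp add: smonom_def fvar_mult_single scl_single bconst_sign)

lemma word_eq_smonom:
  assumes "proper ws"
  shows "\<exists>e\<in>{1, -1}. word ws = scl e (smonom (content ws))"
  using assms
proof (induction ws rule: proper.induct)
  case 1
  thus ?case by (simp add: smonom_one)
next
  case (2 a r ws)
  hence "proper ws" by simp
  from "2.IH"[OF this] obtain e where e: "e \<in> {1, -1}" "word ws = scl e (smonom (content ws))"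
    by blast
  thus ?case
    using boson_mult_smonom[of "(a, r)" "fst (content ws)" "snd (content ws)"]
    by (intro bexI[of _ e]) (simp_all add: scl_mult_right)
next
  case (3 b r ws)
  hence "proper ws" by simp
  from "3.IH"[OF this] obtain e where e: "e \<in> {1, -1}" "word ws = scl e (smonom (content ws))"
    by blast
  let ?n = "card {w \<in> snd (content ws). fpos w < fpos (b, r)}"
  have "e * (-1) ^ ?n \<in> {1, -1}"
    using e(1) by (cases "even ?n") auto
  moreover have "word ((Inr b, r) # ws) = scl (e * (-1) ^ ?n) (smonom (content ((Inr b, r) # ws)))"
    using 3 e(2) fermion_mult_smonom[of "(b, r)" "fst (content ws)" "snd (content ws)"]
    by (simp add: scl_mult_right mult.commute)
  ultimately show ?case by blast
qed

lemma degree_in_content: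
  assumes "proper ws"
  shows "degree_in s (content ws) = length (filter (\<lambda>x. snd x = s) ws)"
  using assms
proof (induction ws rule: proper.induct)
  case 1
  thus ?case by (simp add: degree_in_def)
next
  case (2 a r ws)
  thus ?case
    using degree_in_mult[of "{}" "snd (content ws)" s "psingle (a, r) 1" "fst (content ws)"]
    by (simp add: degree_in_def exp_degree_single)
next
  case (3 b r ws)
  have "{v \<in> {(b, r)}. snd v = s} = (if r = s then {(b, r)} else {})" by auto
  hence "degree_in s (0, {(b, r)}) = (if r = s then 1 else 0)"
    by (simp only: degree_in_def fst_conv snd_conv exp_degree_zero) simp
  thus ?case
    using 3 degree_in_mult[of "{(b, r)}" "snd (content ws)" s 0 "fst (content ws)"] by simp
qed

lemma ex_word_with_content:
  assumes "finite F"
  shows "\<exists>ws. proper ws \<and> content ws = (m, F) \<and> set ws = letters (m, F)"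
proof -
  have fermions: "\<exists>ws. proper ws \<and> content ws = (0, F) \<and> set ws = letters (0, F)"
    using assms
  proof (induction F rule: finite_induct)
    case empty
    show ?case by (rule exI[of _ "[]"]) (simp add: letters_def)
  next
    case (insert v F)
    then obtain ws where "proper ws" "content ws = (0, F)" "set ws = letters (0, F)" by blast
    moreover obtain b r where "v = (b, r)" by (cases v)
    ultimately show ?case using insert.hyps
      by (intro exI[of _ "(Inr b, r) # ws"]) (auto simp: letters_def)
  qed
  show ?thesis
  proof (induction "\<Sum>v\<in>psupp m. pcoeff m v" arbitrary: m)
    case 0
    hence "\<forall>v\<in>psupp m. pcoeff m v = 0" by simp
    hence "m = 0" by (intro poly_mapping_eqI) (metis in_keys_iff lookup_zero)
    thus ?case using fermions by simp
  next
    case (Suc n)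
    then obtain v where v: "v \<in> psupp m" by (metis sum.not_neutral_contains_not_neutral nat.discI)
    define m' where "m' = m - psingle v 1"
    have m: "m = psingle v 1 + m'"
      using v by (intro poly_mapping_eqI)
        (auto simp: m'_def lookup_add lookup_minus lookup_single when_def in_keys_iff)
    have keys: "psupp m = insert v (psupp m')"
      unfolding m by (auto simp: in_keys_iff lookup_add lookup_single when_def split: if_splits)
    have "(\<Sum>w\<in>psupp m. pcoeff m w) = (\<Sum>w\<in>psupp m. pcoeff (psingle v 1) w + pcoeff m' w)"
      by (intro sum.cong refl) (subst m, rule lookup_add)
    also have "\<dots> = Suc (\<Sum>w\<in>psupp m. pcoeff m' w)"
      using v by (simp add: sum.distrib lookup_single when_def)
    also have "(\<Sum>w\<in>psupp m. pcoeff m' w) = (\<Sum>w\<in>psupp m'. pcoeff m' w)"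
      by (intro sum.mono_neutral_right) (auto simp: keys in_keys_iff)
    finally have "n = (\<Sum>w\<in>psupp m'. pcoeff m' w)" using Suc.hyps(2) by simp
    from Suc.hyps(1)[OF this] obtain ws where
      "proper ws" "content ws = (m', F)" "set ws = letters (m', F)" by blast
    moreover obtain a r where v': "v = (a, r)" by (cases v)
    moreover have "letters (m, F) = insert (Inl a, r) (letters (m', F))"
      by (simp add: letters_def keys v')
    ultimately show ?case
      by (intro exI[of _ "(Inl a, r) # ws"]) (simp add: m)
  qed
qed

text \<open>
  Since the sign is its own inverse, \<open>word_eq_smonom\<close> can be solved for the monomial.
\<close>

lemma smonom_eq_word:
  assumes "finite (snd M)"
  obtains e ws where "e \<in> {1, -1}" "proper ws" "content ws = M" "set ws = letters M"
    "smonom M = scl e (word ws)"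
proof -
  obtain ws where ws: "proper ws" "content ws = M" "set ws = letters M"
    using ex_word_with_content[OF assms, of "fst M"] by auto
  then obtain e where e: "e \<in> {1, -1}" "word ws = scl e (smonom M)"
    using word_eq_smonom by blast
  hence "smonom M = scl e (word ws)" by auto
  with ws e that show ?thesis by blast
qed

text \<open>
  Words span the ring, since every monomial is plus or minus a word.
\<close>

lemma superpoly_word_induct:
  assumes "fin p" "P 0" "\<And>p q. P p \<Longrightarrow> P q \<Longrightarrow> P (p + q)"
    and word: "\<And>c ws M. M \<in> supp p \<Longrightarrow> set ws = letters M \<Longrightarrow> P (scl c (word ws))"
  shows "P p"
proof (rule superpoly_smonom_induct)
  fix c M assume M: "M \<in> supp p"
  with assms(1) have "finite (snd M)" by (simp add: fin_iff_supp)
  then obtain e ws where "set ws = letters M" "smonom M = scl e (word ws)"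
    by (rule smonom_eq_word)
  thus "P (scl c (smonom M))" using word[OF M, of ws "c * e"] by simp
qed (use assms in auto)

lemma super_act_mult:
  assumes "fin p" "fin q"
  shows "super_act g (p \<star> q) = super_act g p \<star> super_act g q"
proof -
  have "super_act g (word us \<star> q) = super_act g (word us) \<star> super_act g q" for us
  proof (induction us)
    case (Cons x us)
    thus ?case using assms(2) by (simp add: super_mult_assoc super_act_gvar_mult)
  qed simp
  thus ?thesis
    by - (rule superpoly_word_induct[where p = p],
        use assms in \<open>simp_all add: super_mult_add_left super_act_add scl_mult_left super_act_scl\<close>)
qed

text \<open>
  Both sides are algebra homomorphisms, so it suffices to compare them on the variables.
\<close>

lemma super_act_matrix_mult:
  assumes "fin p"
  shows "super_act (g ** h) p = super_act g (super_act h p)"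
proof -
  have gen: "super_act (g ** h) (gvar x) = super_act g (super_act h (gvar x))" for x
  proof -
    obtain c s where x: "x = (c, s)" by (cases x)
    have "super_act g (super_act h (gvar x)) =
        (\<Sum>r\<in>UNIV. \<Sum>q\<in>UNIV. scl (h $ r $ s * g $ q $ r) (gvar (c, q)))"
      unfolding x super_act_gvar super_act_sum super_act_scl scl_sum by simp
    also have "\<dots> = (\<Sum>q\<in>UNIV. \<Sum>r\<in>UNIV. scl (g $ q $ r * h $ r $ s) (gvar (c, q)))"
      by (subst sum.swap) (simp add: mult.commute)
    also have "\<dots> = (\<Sum>q\<in>UNIV. scl ((g ** h) $ q $ s) (gvar (c, q)))"
    proof -
      have "scl (sum f A) p = (\<Sum>x\<in>A. scl (f x) p)" for f :: "2 \<Rightarrow> complex" and A p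
        by (induction A rule: infinite_finite_induct) (simp_all add: scl_add)
      thus ?thesis by (simp add: matrix_matrix_mult_def)
    qed
    finally show ?thesis unfolding x super_act_gvar ..
  qed
  have "super_act (g ** h) (word ws) = super_act g (super_act h (word ws))" for ws
    by (induction ws) (simp_all add: super_act_mult gen)
  thus ?thesis
    by - (rule superpoly_word_induct[where p = p],
        use assms in \<open>simp_all add: super_act_add super_act_scl\<close>)
qed

lemma super_act_one:
  assumes "fin p"
  shows "super_act (mat 1) p = p"
proof -
  have gen: "super_act (mat 1) (gvar x) = gvar x" for x
  proof -
    obtain c s where x: "x = (c, s)" by (cases x)
    have "(\<Sum>r\<in>UNIV. scl (mat 1 $ r $ s) (gvar (c, r))) = (\<Sum>r\<in>UNIV. if r = s then gvar (c, r) else 0)"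
      by (intro sum.cong) (auto simp: mat_def)
    thus ?thesis unfolding x super_act_gvar by simp
  qed
  have "super_act (mat 1) (word ws) = word ws" for ws
    by (induction ws) (simp_all add: super_act_mult gen)
  thus ?thesis
    by - (rule superpoly_word_induct[where p = p],
        use assms in \<open>simp_all add: super_act_add super_act_scl\<close>)
qed

section \<open>The ring and its bigrading\<close>

definition mons :: "nat \<Rightarrow> nat \<Rightarrow> mon set" where
  "mons k j = {M. psupp (fst M) \<subseteq> {1..k} \<times> UNIV \<and> snd M \<subseteq> {1..j} \<times> UNIV}"

lemma carrier_super_ring: "carrier (super_ring k j) = {p. supp p \<subseteq> mons k j}"
proof -
  have ne: "\<exists>m. m \<in> psupp (pcoeff p F)" if "F \<in> psupp p" for F and p :: superpoly
    using that by (metis all_not_in_conv in_keys_iff keys_eq_empty)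
  have "(\<forall>F\<in>psupp p. F \<subseteq> {1..j} \<times> UNIV \<and>
          (\<forall>m\<in>psupp (pcoeff p F). psupp m \<subseteq> {1..k} \<times> UNIV)) \<longleftrightarrow> supp p \<subseteq> mons k j" for p
    unfolding supp_eq mons_def using ne[of _ p] by (fastforce simp: image_subset_iff)
  thus ?thesis by (simp add: super_ring_def)
qed

lemma mons_finite: "M \<in> mons k j \<Longrightarrow> finite (snd M)"
  unfolding mons_def using finite_subset[of "snd M" "{1..j} \<times> UNIV"] by auto

lemma carrier_fin: "p \<in> carrier (super_ring k j) \<Longrightarrow> fin p"
  using mons_finite by (auto simp: carrier_super_ring fin_iff_supp)

lemma supp_add: "supp (p + q) \<subseteq> supp p \<union> supp q"
  by (auto simp: supp_def)

lemma supp_diff: "supp (p - q) \<subseteq> supp p \<union> supp q"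
  by (auto simp: supp_def)

lemma supp_scl: "supp (scl c p) \<subseteq> supp p"
  by (auto simp: supp_def)

lemma supp_uminus [simp]: "supp (- p) = supp p"
  by (simp add: supp_def)

lemma supp_zero [simp]: "supp 0 = {}"
  by (simp add: supp_def)

lemma supp_smonom [simp]: "supp (smonom M) = {M}"
  by (auto simp: supp_def coef_smonom)

lemma supp_sum: "supp (sum f A) \<subseteq> (\<Union>x\<in>A. supp (f x))"
  unfolding supp_def by (auto simp: coef_sum intro: ccontr)

lemma smonom_mult: "\<exists>e. smonom M \<star> smonom M' =
  (if snd M \<inter> snd M' = {} then scl e (smonom (fst M + fst M', snd M \<union> snd M')) else 0)"
  by (rule exI[of _ "(-1) ^ card {(u, v). u \<in> snd M \<and> v \<in> snd M' \<and> fpos v < fpos u}"])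
     (simp add: smonom_def super_mult_single scl_single bconst_sign ferm_sign_def mult_single mult.assoc)

text \<open>
  The product of two monomials is zero or a multiple of their combined monomial, so no other
  monomials can occur in a product.
\<close>

lemma supp_mult:
  "supp (p \<star> q) \<subseteq> {(fst M + fst M', snd M \<union> snd M') | M M'.
     M \<in> supp p \<and> M' \<in> supp q \<and> snd M \<inter> snd M' = {}}" (is "_ \<subseteq> ?T")
proof -
  have "p \<star> q = (\<Sum>M\<in>supp p. \<Sum>M'\<in>supp q. scl (coef p M * coef q M') (smonom M \<star> smonom M'))"
    by (subst superpoly_eq_sum_smonom[of p], subst super_mult_sum_left,
        subst superpoly_eq_sum_smonom[of q], subst super_mult_sum_right)
       (simp add: scl_mult_left scl_mult_right mult.commute)
  also have "supp \<dots> \<subseteq> (\<Union>M\<in>supp p. \<Union>M'\<in>supp q.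
      supp (scl (coef p M * coef q M') (smonom M \<star> smonom M')))"
    by (intro order_trans[OF supp_sum] UN_mono order_refl)
  also have "\<dots> \<subseteq> ?T"
  proof (intro UN_least)
    fix M M' assume M: "M \<in> supp p" "M' \<in> supp q"
    have "supp (smonom M \<star> smonom M') \<subseteq> ?T"
    proof (cases "snd M \<inter> snd M' = {}")
      case True
      then obtain e where "smonom M \<star> smonom M' = scl e (smonom (fst M + fst M', snd M \<union> snd M'))"
        using smonom_mult[of M M'] by auto
      hence "supp (smonom M \<star> smonom M') \<subseteq> {(fst M + fst M', snd M \<union> snd M')}"
        using supp_scl[of e "smonom (fst M + fst M', snd M \<union> snd M')"] by simp
      also have "\<dots> \<subseteq> ?T" using M True by blast
      finally show ?thesis .
    next
      case False
      thus ?thesis using smonom_mult[of M M'] by simp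
    qed
    thus "supp (scl (coef p M * coef q M') (smonom M \<star> smonom M')) \<subseteq> ?T"
      using supp_scl by blast
  qed
  finally show ?thesis .
qed

context
  fixes k j :: nat
begin

lemma super_ring_ops [simp]:
  "\<zero>\<^bsub>super_ring k j\<^esub> = 0" "\<one>\<^bsub>super_ring k j\<^esub> = sone"
  "x \<oplus>\<^bsub>super_ring k j\<^esub> y = x + y" "x \<otimes>\<^bsub>super_ring k j\<^esub> y = x \<star> y"
  by (simp_all add: super_ring_def)

lemma super_add_closed: "p \<in> carrier (super_ring k j) \<Longrightarrow> q \<in> carrier (super_ring k j) \<Longrightarrow> p + q \<in> carrier (super_ring k j)"
  using supp_add[of p q] by (auto simp: carrier_super_ring)

lemma super_diff_closed: "p \<in> carrier (super_ring k j) \<Longrightarrow> q \<in> carrier (super_ring k j) \<Longrightarrow> p - q \<in> carrier (super_ring k j)"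
  using supp_diff[of p q] by (auto simp: carrier_super_ring)

lemma super_uminus_closed: "p \<in> carrier (super_ring k j) \<Longrightarrow> - p \<in> carrier (super_ring k j)"
  by (simp add: carrier_super_ring)

lemma scl_closed: "p \<in> carrier (super_ring k j) \<Longrightarrow> scl c p \<in> carrier (super_ring k j)"
  using supp_scl[of c p] by (auto simp: carrier_super_ring)

lemma super_zero_closed: "0 \<in> carrier (super_ring k j)"
  by (simp add: carrier_super_ring)

lemma smonom_in_carrier_iff: "smonom M \<in> carrier (super_ring k j) \<longleftrightarrow> M \<in> mons k j"
  by (simp add: carrier_super_ring)

lemma sone_closed: "sone \<in> carrier (super_ring k j)"
  unfolding smonom_one[symmetric] smonom_in_carrier_iff by (simp add: mons_def)

lemma super_const_closed: "super_const c \<in> carrier (super_ring k j)"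
  unfolding super_const_eq_scl by (intro scl_closed sone_closed)

lemma super_sum_closed: "(\<And>x. x \<in> A \<Longrightarrow> f x \<in> carrier (super_ring k j)) \<Longrightarrow> sum f A \<in> carrier (super_ring k j)"
  by (induction A rule: infinite_finite_induct) (auto intro: super_add_closed super_zero_closed)

lemma super_mult_closed:
  assumes "p \<in> carrier (super_ring k j)" "q \<in> carrier (super_ring k j)"
  shows "p \<star> q \<in> carrier (super_ring k j)"
proof -
  have "(fst M + fst M', snd M \<union> snd M') \<in> mons k j" if "M \<in> mons k j" "M' \<in> mons k j" for M M'
    using that Poly_Mapping.keys_add[of "fst M" "fst M'"] by (auto simp: mons_def)
  thus ?thesis
    using assms supp_mult[of p q] unfolding carrier_super_ring by blast
qed

lemma ring_super_ring: "ring (super_ring k j)"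
proof (intro ringI abelian_groupI monoidI)
  fix x y z assume "x \<in> carrier (super_ring k j)" "y \<in> carrier (super_ring k j)" "z \<in> carrier (super_ring k j)"
  thus "x \<otimes>\<^bsub>super_ring k j\<^esub> y \<otimes>\<^bsub>super_ring k j\<^esub> z = x \<otimes>\<^bsub>super_ring k j\<^esub> (y \<otimes>\<^bsub>super_ring k j\<^esub> z)"
    by (simp add: super_mult_assoc carrier_fin)
next
  fix x assume "x \<in> carrier (super_ring k j)"
  thus "\<exists>y\<in>carrier (super_ring k j). y \<oplus>\<^bsub>super_ring k j\<^esub> x = \<zero>\<^bsub>super_ring k j\<^esub>"
    by (intro bexI[of _ "- x"]) (simp_all add: super_uminus_closed)
qed (simp_all add: super_add_closed super_mult_closed super_zero_closed sone_closed super_mult_add_left super_mult_add_right add_ac)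

definition range_letters :: "letter set" where
  "range_letters = {(c, r). case c of Inl a \<Rightarrow> a \<in> {1..k} | Inr b \<Rightarrow> b \<in> {1..j}}"

lemma letters_subset: "M \<in> mons k j \<Longrightarrow> letters M \<subseteq> range_letters"
  by (fastforce simp: mons_def letters_def range_letters_def)

lemma range_letters_iff: "(c, r) \<in> range_letters \<longleftrightarrow> (c, s) \<in> range_letters"
  by (simp add: range_letters_def)

lemma content_in_mons: "set ws \<subseteq> range_letters \<Longrightarrow> content ws \<in> mons k j"
proof (induction ws rule: content.induct)
  case (2 a r ws)
  thus ?case using Poly_Mapping.keys_add[of "psingle (a, r) 1" "fst (content ws)"]
    by (auto simp: mons_def range_letters_def)
qed (auto simp: mons_def range_letters_def)

lemma gvar_closed: "x \<in> range_letters \<Longrightarrow> gvar x \<in> carrier (super_ring k j)"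
proof (cases x rule: gvar.cases)
  case (1 a r)
  moreover assume "x \<in> range_letters"
  moreover have "gvar x = smonom (psingle (a, r) 1, {})"
    using 1 boson_mult_smonom[of "(a, r)" 0 "{}"] by (simp add: smonom_one)
  ultimately show ?thesis by (auto simp: smonom_in_carrier_iff mons_def range_letters_def)
next
  case (2 b r)
  moreover assume "x \<in> range_letters"
  moreover have "gvar x = smonom (0, {(b, r)})"
    using 2 fermion_mult_smonom[of "(b, r)" 0 "{}"] by (simp add: smonom_one)
  ultimately show ?thesis by (auto simp: smonom_in_carrier_iff mons_def range_letters_def)
qed

lemma word_closed: "set ws \<subseteq> range_letters \<Longrightarrow> word ws \<in> carrier (super_ring k j)"
  by (induction ws) (auto intro: sone_closed super_mult_closed gvar_closed)

lemma super_act_closed: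
  assumes "p \<in> carrier (super_ring k j)"
  shows "super_act g p \<in> carrier (super_ring k j)"
proof (rule superpoly_word_induct[where p = p])
  fix c ws M assume M: "M \<in> supp p" "set ws = letters M"
  hence "M \<in> mons k j" using assms by (auto simp: carrier_super_ring)
  hence "set ws \<subseteq> range_letters" using letters_subset M(2) by metis
  hence "super_act g (word ws) \<in> carrier (super_ring k j)"
  proof (induction ws)
    case (Cons x ws)
    obtain c s where x: "x = (c, s)" by (cases x)
    have "gvar (c, r) \<in> carrier (super_ring k j)" for r
      using Cons.prems range_letters_iff[of c r s] by (intro gvar_closed) (simp add: x)
    hence "super_act g (gvar x) \<in> carrier (super_ring k j)"
      unfolding x super_act_gvar by (intro super_sum_closed scl_closed)
    thus ?case using Cons by (simp add: super_act_gvar_mult super_mult_closed)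
  qed (simp add: sone_closed)
  thus "super_act g (scl c (word ws)) \<in> carrier (super_ring k j)"
    by (simp add: super_act_scl scl_closed)
qed (use assms in \<open>simp_all add: carrier_fin super_act_add super_add_closed super_zero_closed\<close>)

end

definition bidegree :: "mon \<Rightarrow> nat \<times> nat" where
  "bidegree M = (degree_in 1 M, degree_in 2 M)"

definition degs :: "superpoly \<Rightarrow> (nat \<times> nat) set" where
  "degs p = bidegree ` supp p"

lemma degs_mult:
  assumes "fin p" "fin q"
  shows "degs (p \<star> q) \<subseteq> {(a + c, b + d) | a b c d. (a, b) \<in> degs p \<and> (c, d) \<in> degs q}"
proof
  fix x assume "x \<in> degs (p \<star> q)"
  then obtain M M' where M: "M \<in> supp p" "M' \<in> supp q" "snd M \<inter> snd M' = {}"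
    and x: "x = bidegree (fst M + fst M', snd M \<union> snd M')"
    using supp_mult[of p q] unfolding degs_def by blast
  have "finite (snd M)" "finite (snd M')" using assms M by (auto simp: fin_iff_supp)
  hence "x = (degree_in 1 M + degree_in 1 M', degree_in 2 M + degree_in 2 M')"
    using M(3) unfolding x bidegree_def by (simp add: degree_in_mult)
  moreover have "(degree_in 1 M, degree_in 2 M) \<in> degs p" "(degree_in 1 M', degree_in 2 M') \<in> degs q"
    using M by (auto simp: degs_def bidegree_def)
  ultimately show "x \<in> {(a + c, b + d) | a b c d. (a, b) \<in> degs p \<and> (c, d) \<in> degs q}" by blast
qed

lemma coef_zero_iff_degs: "(\<forall>M. bidegree M \<in> B \<longrightarrow> coef p M = 0) \<longleftrightarrow> degs p \<inter> B = {}"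
  by (auto simp: degs_def supp_def)

section \<open>Diagonal and antidiagonal matrices\<close>

definition other :: "2 \<Rightarrow> 2" where "other s = (if s = 1 then 2 else 1)"

lemma other_other [simp]: "other (other s) = s"
  using exhaust_2[of s] by (auto simp: other_def)

lemma other_neq [simp]: "other s \<noteq> s"
  by (auto simp: other_def)

lemma other_simps [simp]: "other 1 = 2" "other 2 = 1"
  by (simp_all add: other_def)

lemma neq_iff_other: "r \<noteq> s \<longleftrightarrow> r = other s"
  using exhaust_2[of s] exhaust_2[of r] by (auto simp: other_def)

definition swap_matrix :: "complex^2^2" where
  "swap_matrix = (\<chi> r s. if r = other s then 1 else 0)"

definition diag_matrix :: "complex \<Rightarrow> complex \<Rightarrow> complex^2^2" where
  "diag_matrix a b = (\<chi> r s. if r = s then if s = 1 then a else b else 0)"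

definition swap_letter :: "letter \<Rightarrow> letter" where
  "swap_letter x = (fst x, other (snd x))"

lemma swap_letter_simps [simp]: "swap_letter (c, s) = (c, other s)"
  by (simp add: swap_letter_def)

lemma act_swap_gvar: "super_act swap_matrix (gvar x) = gvar (swap_letter x)"
proof -
  obtain c s where x: "x = (c, s)" by (cases x)
  have "(\<Sum>r\<in>UNIV. scl (swap_matrix $ r $ s) (gvar (c, r)))
      = (\<Sum>r\<in>UNIV. if r = other s then gvar (c, r) else 0)"
    by (intro sum.cong) (auto simp: swap_matrix_def)
  thus ?thesis unfolding x super_act_gvar by (simp add: swap_letter_def)
qed

lemma act_swap_word: "super_act swap_matrix (word ws) = word (map swap_letter ws)"
  by (induction ws) (simp_all add: super_act_gvar_mult act_swap_gvar)

lemma act_diag_gvar: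
  "super_act (diag_matrix a b) (gvar x) = scl (if snd x = 1 then a else b) (gvar x)"
proof -
  obtain c s where x: "x = (c, s)" by (cases x)
  have "(\<Sum>r\<in>UNIV. scl (diag_matrix a b $ r $ s) (gvar (c, r)))
      = (\<Sum>r\<in>UNIV. if r = s then scl (if s = 1 then a else b) (gvar (c, r)) else 0)"
    by (intro sum.cong) (auto simp: diag_matrix_def)
  thus ?thesis unfolding x super_act_gvar by simp
qed

lemma act_diag_word: "super_act (diag_matrix a b) (word ws) =
  scl (a ^ length (filter (\<lambda>x. snd x = 1) ws) * b ^ length (filter (\<lambda>x. snd x = 2) ws)) (word ws)"
proof (induction ws)
  case (Cons x ws)
  have "snd x = 1 \<and> snd x \<noteq> 2 \<or> snd x = 2 \<and> snd x \<noteq> 1"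
    using neq_iff_other[of "snd x" 1] neq_iff_other[of "snd x" 2] by auto
  thus ?case
    using Cons by (elim disjE) (simp_all add: super_act_gvar_mult act_diag_gvar scl_mult_left scl_mult_right mult_ac)
qed simp

lemma act_diag_smonom:
  assumes "finite (snd M)"
  shows "super_act (diag_matrix a b) (smonom M) = scl (a ^ degree_in 1 M * b ^ degree_in 2 M) (smonom M)"
proof -
  obtain e ws where "proper ws" "content ws = M" and M: "smonom M = scl e (word ws)"
    using smonom_eq_word[OF assms] by metis
  hence "degree_in s M = length (filter (\<lambda>x. snd x = s) ws)" for s
    using degree_in_content by metis
  thus ?thesis by (simp add: M super_act_scl act_diag_word mult.commute)
qed

lemma coef_act_diag:
  assumes "fin p"
  shows "coef (super_act (diag_matrix a b) p) M = a ^ degree_in 1 M * b ^ degree_in 2 M * coef p M"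
proof (rule superpoly_smonom_induct[where p = p])
  fix c N assume "N \<in> supp p"
  hence "finite (snd N)" using assms by (simp add: fin_iff_supp)
  thus "coef (super_act (diag_matrix a b) (scl c (smonom N))) M
      = a ^ degree_in 1 M * b ^ degree_in 2 M * coef (scl c (smonom N)) M"
    by (simp add: super_act_scl act_diag_smonom coef_smonom)
qed (simp_all add: super_act_add algebra_simps)

definition swap_var :: "var \<Rightarrow> var" where
  "swap_var v = (fst v, other (snd v))"

lemma swap_var_swap_var [simp]: "swap_var (swap_var v) = v"
  by (simp add: swap_var_def)

lemma inj_swap_var: "inj swap_var"
  by (rule inj_on_inverseI[of _ swap_var]) simp

definition swap_mon :: "mon \<Rightarrow> mon" where
  "swap_mon M = (Poly_Mapping.map_key swap_var (fst M), swap_var ` snd M)"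

lemma lookup_map_key_swap: "pcoeff (Poly_Mapping.map_key swap_var m) v = pcoeff m (swap_var v)"
  by (simp add: map_key.rep_eq inj_swap_var)

lemma swap_mon_swap_mon [simp]: "swap_mon (swap_mon M) = M"
  by (auto simp: swap_mon_def prod_eq_iff image_image lookup_map_key_swap intro!: poly_mapping_eqI)

lemma finite_swap_mon [simp]: "finite (snd (swap_mon M)) \<longleftrightarrow> finite (snd M)"
  using finite_imageD[of swap_var "snd M"] inj_swap_var
  by (auto simp: swap_mon_def intro: inj_on_subset)

lemma swap_mon_in_mons: "M \<in> mons k j \<Longrightarrow> swap_mon M \<in> mons k j"
  by (auto simp: mons_def swap_mon_def swap_var_def in_keys_iff lookup_map_key_swap subset_iff)

lemma content_swap: "content (map swap_letter ws) = swap_mon (content ws)"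
proof (induction ws rule: content.induct)
  case 1
  thus ?case by (auto simp: swap_mon_def lookup_map_key_swap intro!: poly_mapping_eqI)
next
  case (2 a r ws)
  have "Poly_Mapping.map_key swap_var (psingle (a, r) 1 + m) =
      psingle (a, other r) 1 + Poly_Mapping.map_key swap_var m" for m :: "var \<Rightarrow>\<^sub>0 nat"
    by (rule poly_mapping_eqI)
       (auto simp: lookup_map_key_swap lookup_add lookup_single when_def swap_var_def)
  thus ?case using 2 by (simp add: swap_mon_def del: One_nat_def)
next
  case (3 b r ws)
  thus ?case by (simp add: swap_mon_def swap_var_def)
qed

lemma proper_swap: "proper (map swap_letter ws) \<longleftrightarrow> proper ws"
proof (induction ws rule: proper.induct)
  case (3 b r ws)
  have "(b, other r) = swap_var (b, r)" by (simp add: swap_var_def)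
  hence "(b, other r) \<in> snd (content (map swap_letter ws)) \<longleftrightarrow> (b, r) \<in> snd (content ws)"
    unfolding content_swap swap_mon_def by (simp add: inj_image_mem_iff[OF inj_swap_var])
  thus ?case using 3 by simp
qed simp_all

lemma degree_in_swap_mon:
  assumes "finite (snd M)"
  shows "degree_in s (swap_mon M) = degree_in (other s) M"
proof -
  obtain e ws where ws: "proper ws" "content ws = M"
    using smonom_eq_word[OF assms] by metis
  have "degree_in s (swap_mon M) = length (filter (\<lambda>x. snd x = s) (map swap_letter ws))"
    using degree_in_content[of "map swap_letter ws" s] ws by (simp add: content_swap proper_swap)
  also have "\<dots> = length (filter (\<lambda>x. snd x = other s) ws)"
    by (simp add: filter_map o_def swap_letter_def) (metis other_other)
  also have "\<dots> = degree_in (other s) M" using degree_in_content[of ws] ws by metis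
  finally show ?thesis .
qed

lemma bidegree_swap_mon:
  "finite (snd M) \<Longrightarrow> bidegree (swap_mon M) = prod.swap (bidegree M)"
  by (simp add: bidegree_def degree_in_swap_mon)

text \<open>
  The exchange of the subscripts sends a monomial to plus or minus the exchanged monomial; the sign
  stems from sorting the fermionic factors again.
\<close>

definition swap_sign :: "mon \<Rightarrow> complex" where
  "swap_sign M = coef (super_act swap_matrix (smonom M)) (swap_mon M)"

text \<open>
  A monomial is plus or minus a word, the exchange acts on words letter by letter, and the exchanged
  word is again plus or minus a monomial.
\<close>

lemma swap_sign:
  assumes "finite (snd M)"
  shows "swap_sign M \<in> {1, -1}"
    and "super_act swap_matrix (smonom M) = scl (swap_sign M) (smonom (swap_mon M))"
proof -
  obtain e ws where ws: "e \<in> {1, -1}" "proper ws" "content ws = M" "smonom M = scl e (word ws)"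
    using smonom_eq_word[OF assms] by metis
  have "proper (map swap_letter ws)" using ws(2) by (simp add: proper_swap)
  from word_eq_smonom[OF this] obtain d where
    d: "d \<in> {1, -1}" "word (map swap_letter ws) = scl d (smonom (swap_mon M))"
    unfolding content_swap ws(3) by blast
  have eq: "super_act swap_matrix (smonom M) = scl (e * d) (smonom (swap_mon M))"
    by (simp add: ws(4) super_act_scl act_swap_word d(2))
  hence sgn: "swap_sign M = e * d" by (simp add: swap_sign_def coef_smonom)
  show "swap_sign M \<in> {1, -1}" unfolding sgn using ws(1) d(1) by auto
  show "super_act swap_matrix (smonom M) = scl (swap_sign M) (smonom (swap_mon M))"
    using eq sgn by simp
qed

lemma coef_act_swap:
  assumes "fin p"
  shows "coef (super_act swap_matrix p) (swap_mon M) = swap_sign M * coef p M"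
proof (rule superpoly_smonom_induct[where p = p])
  fix c N assume "N \<in> supp p"
  hence "finite (snd N)" using assms by (simp add: fin_iff_supp)
  moreover have "swap_mon N = swap_mon M \<longleftrightarrow> N = M" by (metis swap_mon_swap_mon)
  ultimately show "coef (super_act swap_matrix (scl c (smonom N))) (swap_mon M)
      = swap_sign M * coef (scl c (smonom N)) M"
    by (simp add: super_act_scl swap_sign(2) coef_smonom)
qed (simp_all add: super_act_add algebra_simps)

lemma degs_act_swap:
  assumes "fin p"
  shows "degs (super_act swap_matrix p) \<subseteq> prod.swap ` degs p"
proof
  fix x assume "x \<in> degs (super_act swap_matrix p)"
  then obtain M where M: "coef (super_act swap_matrix p) M \<noteq> 0" "x = bidegree M"
    by (auto simp: degs_def supp_def)
  have "coef p (swap_mon M) \<noteq> 0" using M(1) coef_act_swap[OF assms, of "swap_mon M"] by auto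
  hence N: "swap_mon M \<in> supp p" by (simp add: supp_def)
  hence "finite (snd (swap_mon M))" using assms by (simp add: fin_iff_supp del: finite_swap_mon)
  hence "x = prod.swap (bidegree (swap_mon M))"
    using M(2) by (simp add: bidegree_swap_mon)
  thus "x \<in> prod.swap ` degs p" using N by (auto simp: degs_def)
qed

section \<open>Diagonalising the rotation\<close>

text \<open>
  The columns are eigenvectors of all rotation matrices: \<open>(1, i)\<close> and \<open>(1, -i)\<close>.
\<close>

definition eigenbasis :: "complex^2^2" where
  "eigenbasis = (\<chi> r s. if r = 1 then 1 else if s = 1 then \<i> else - \<i>)"

definition eigenbasis_inv :: "complex^2^2" where
  "eigenbasis_inv = (\<chi> r s. if s = 1 then 1 / 2 else if r = 1 then - \<i> / 2 else \<i> / 2)"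

lemma two_neq_one [simp]: "(2 :: 2) \<noteq> 1" "(1 :: 2) \<noteq> 2"
  using other_neq[of 1] by (simp_all add: eq_commute)

lemma matrix_eq_2:
  "A = B \<longleftrightarrow> A $ 1 $ 1 = B $ 1 $ 1 \<and> A $ 1 $ 2 = B $ 1 $ 2 \<and> A $ 2 $ 1 = B $ 2 $ 1 \<and> A $ 2 $ 2 = B $ 2 $ 2"
  for A B :: "complex^2^2"
  by (auto simp: vec_eq_iff forall_2)

lemma matrix_mult_2: "(A ** B) $ r $ s = A $ r $ 1 * B $ 1 $ s + A $ r $ 2 * B $ 2 $ s"
  for A B :: "complex^2^2"
  by (simp add: matrix_matrix_mult_def sum_2)

lemma eigenbasis_inverse:
  "eigenbasis ** eigenbasis_inv = mat 1" "eigenbasis_inv ** eigenbasis = mat 1"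
  by (simp_all add: matrix_eq_2 matrix_mult_2 eigenbasis_def eigenbasis_inv_def mat_def)

lemma rotation_eigenbasis:
  "dihedral_rotation n ** eigenbasis
     = eigenbasis ** diag_matrix (cis (- (2 * pi / real n))) (cis (2 * pi / real n))"
  by (simp add: matrix_eq_2 matrix_mult_2 eigenbasis_def dihedral_rotation_def Let_def
      diag_matrix_def complex_eq_iff)

lemma reflection_eigenbasis: "dihedral_reflection ** eigenbasis = eigenbasis ** swap_matrix"
  by (simp add: matrix_eq_2 matrix_mult_2 eigenbasis_def dihedral_reflection_def swap_matrix_def)

lemma GL2_group: "group GL2"
proof (rule groupI)
  fix A assume "A \<in> carrier GL2"
  hence "\<exists>B. A ** B = mat 1 \<and> B ** A = mat 1" by (simp add: GL2_def invertible_def)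
  thus "\<exists>B\<in>carrier GL2. B \<otimes>\<^bsub>GL2\<^esub> A = \<one>\<^bsub>GL2\<^esub>" by (auto simp: GL2_def invertible_def)
next
  show "\<one>\<^bsub>GL2\<^esub> \<in> carrier GL2" by (auto simp: GL2_def invertible_def intro: exI[of _ "mat 1"])
qed (auto simp: GL2_def matrix_mul_assoc intro: invertible_mult)

lemma dihedral_generators_in_GL2:
  "dihedral_rotation n \<in> carrier GL2" "dihedral_reflection \<in> carrier GL2"
proof -
  have "(complex_of_real (cos x))\<^sup>2 + (complex_of_real (sin x))\<^sup>2 = 1" for x
    by (metis of_real_1 of_real_add of_real_power sin_cos_squared_add2)
  thus "dihedral_rotation n \<in> carrier GL2"
    by (simp add: GL2_def invertible_det_nz det_2 dihedral_rotation_def Let_def power2_eq_square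
        eq_neg_iff_add_eq_0)
  show "dihedral_reflection \<in> carrier GL2"
    by (simp add: GL2_def invertible_det_nz det_2 dihedral_reflection_def)
qed

text \<open>
  The matrices that fix \<open>p\<close> are closed under products and inverses, because the action respects the
  matrix product.
\<close>

lemma dihedral_group_fixes:
  assumes p: "fin p" "super_act (dihedral_rotation n) p = p" "super_act dihedral_reflection p = p"
    and g: "g \<in> dihedral_group n"
  shows "super_act g p = p"
  using g unfolding dihedral_group_def
proof (induction rule: generate.induct)
  case one
  show ?case using p(1) by (simp add: GL2_def super_act_one)
next
  case (incl h)
  thus ?case using p by auto
next
  case (inv h)
  hence h: "h \<in> carrier GL2" "super_act h p = p"
    using dihedral_generators_in_GL2 p by auto
  have "m_inv GL2 h \<otimes>\<^bsub>GL2\<^esub> h = \<one>\<^bsub>GL2\<^esub>"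
    using h(1) by (rule group.l_inv[OF GL2_group])
  hence "(m_inv GL2 h) ** h = mat 1" by (simp add: GL2_def)
  hence "super_act (m_inv GL2 h) (super_act h p) = p"
    using p(1) by (simp add: super_act_one flip: super_act_matrix_mult)
  thus ?case using h(2) by simp
next
  case (eng g h)
  thus ?case using p(1) by (simp add: GL2_def super_act_matrix_mult)
qed

lemma act_eigenbasis_cancel:
  assumes "fin p"
  shows "super_act eigenbasis (super_act eigenbasis_inv p) = p"
    and "super_act eigenbasis_inv (super_act eigenbasis p) = p"
  using assms by (simp_all add: eigenbasis_inverse super_act_one flip: super_act_matrix_mult)

lemma act_conjugate:
  assumes "fin p" "g ** eigenbasis = eigenbasis ** h"
  shows "super_act g (super_act eigenbasis p) = super_act eigenbasis (super_act h p)"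
  using super_act_matrix_mult[OF assms(1), of g eigenbasis]
    super_act_matrix_mult[OF assms(1), of eigenbasis h] assms(2) by simp

section \<open>Constant terms, graded parts and reordering of words\<close>

lemma coef_gvar_mult_zero:
  assumes "fin p"
  shows "coef (gvar x \<star> p) (0, {}) = 0"
proof (rule superpoly_smonom_induct[where p = p])
  fix c M
  show "coef (gvar x \<star> scl c (smonom M)) (0, {}) = 0"
  proof (cases x rule: gvar.cases)
    case (1 a r)
    have "psingle (a, r) 1 + fst M \<noteq> 0"
    proof
      assume "psingle (a, r) 1 + fst M = 0"
      hence "pcoeff (psingle (a, r) 1 + fst M) (a, r) = 0" by simp
      thus False by (simp add: lookup_add)
    qed
    thus ?thesis
      using 1 boson_mult_smonom[of "(a, r)" "fst M" "snd M"] by (simp add: scl_mult_right coef_smonom)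
  next
    case (2 b r)
    thus ?thesis
      using fermion_mult_smonom[of "(b, r)" "fst M" "snd M"] by (simp add: scl_mult_right coef_smonom)
  qed
qed (simp_all add: super_mult_add_right)

text \<open>
  A matrix sends variables to combinations of variables, so it maps words of positive length to
  elements without constant term.
\<close>

lemma coef_super_act_zero:
  assumes "fin p"
  shows "coef (super_act g p) (0, {}) = coef p (0, {})"
proof (rule superpoly_word_induct[where p = p])
  fix c ws
  have "coef (super_act g (word ws)) (0, {}) = coef (word ws) (0, {})"
  proof (cases ws)
    case (Cons x us)
    obtain c s where x: "x = (c, s)" by (cases x)
    have "coef (super_act g (word ws)) (0, {}) = 0"
      by (simp add: Cons super_act_gvar_mult x super_act_gvar super_mult_sum_left scl_mult_left
          coef_sum coef_gvar_mult_zero)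
    thus ?thesis by (simp add: Cons coef_gvar_mult_zero)
  qed simp
  thus "coef (super_act g (scl c (word ws))) (0, {}) = coef (scl c (word ws)) (0, {})"
    by (simp add: super_act_scl)
qed (use assms in \<open>simp_all add: super_act_add\<close>)

lemma coef_infinite: "fin p \<Longrightarrow> infinite (snd M) \<Longrightarrow> coef p M = 0"
  unfolding fin_iff_supp supp_def by blast

lemma bidegree_zero: "bidegree (0, {}) = (0, 0)"
  by (simp add: bidegree_def degree_in_def)

text \<open>
  A word that spells such a monomial has no letters of either subscript, hence is empty.
\<close>

lemma bidegree_eq_zero:
  assumes "finite (snd M)" "bidegree M = (0, 0)"
  shows "M = (0, {})"
proof -
  obtain e ws where ws: "proper ws" "content ws = M"
    using smonom_eq_word[OF assms(1)] by metis
  have "filter (\<lambda>x. snd x = s) ws = []" for s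
    using degree_in_content[OF ws(1), of s] assms(2) exhaust_2[of s] ws(2)
    by (auto simp: bidegree_def)
  hence "ws = []" by (metis (mono_tags, lifting) filter_empty_conv list.set_intros(1) neq_Nil_conv)
  thus ?thesis using ws(2) by simp
qed

lemma degs_act_swap_disjoint:
  assumes "fin p" "degs p \<inter> B = {}" "prod.swap ` B = B"
  shows "degs (super_act swap_matrix p) \<inter> B = {}"
proof -
  have "prod.swap x \<in> degs p" if "x \<in> degs (super_act swap_matrix p)" for x
    using degs_act_swap[OF assms(1)] that by auto
  moreover have "prod.swap x \<in> B" if "x \<in> B" for x
    using that assms(3) by blast
  ultimately show ?thesis using assms(2) by blast
qed

definition graded_part :: "(nat \<times> nat) set \<Rightarrow> superpoly \<Rightarrow> superpoly" where
  "graded_part B p = (\<Sum>M\<in>{M\<in>supp p. bidegree M \<in> B}. scl (coef p M) (smonom M))"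

lemma coef_graded_part: "coef (graded_part B p) M = (if bidegree M \<in> B then coef p M else 0)"
proof -
  have "coef (graded_part B p) M
      = (\<Sum>N\<in>{N\<in>supp p. bidegree N \<in> B}. if N = M then coef p N else 0)"
    by (simp add: graded_part_def coef_sum coef_smonom if_distrib cong: if_cong)
  also have "\<dots> = (if M \<in> {N\<in>supp p. bidegree N \<in> B} then coef p M else 0)"
    by (subst sum.delta) auto
  also have "\<dots> = (if bidegree M \<in> B then coef p M else 0)" by (auto simp: supp_def)
  finally show ?thesis .
qed

lemma supp_graded_part: "supp (graded_part B p) = {M \<in> supp p. bidegree M \<in> B}"
  by (auto simp: supp_def coef_graded_part)

text \<open>
  The scalar is the product of the commutation signs of \<open>x\<close> with the letters before it.
\<close>

lemma word_move_front:
  "x \<in> set ws \<Longrightarrow> \<exists>e. word ws = scl e (word (x # remove1 x ws))"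
proof (induction ws)
  case (Cons y ws)
  show ?case
  proof (cases "x = y")
    case True
    thus ?thesis by (intro exI[of _ 1]) simp
  next
    case False
    then obtain e where "word ws = scl e (word (x # remove1 x ws))" using Cons by auto
    hence "word (y # ws) = scl e (gvar y \<star> gvar x \<star> word (remove1 x ws))"
      by (simp add: scl_mult_right super_mult_assoc)
    also have "\<dots> = scl (e * comm_sign (fst y) (fst x)) (word (x # remove1 x (y # ws)))"
      using False by (subst gvar_commute) (simp add: scl_mult_left super_mult_assoc)
    finally show ?thesis by blast
  qed
qed simp

abbreviation num_letters :: "2 \<Rightarrow> letter list \<Rightarrow> nat" where
  "num_letters s ws \<equiv> length (filter (\<lambda>x. snd x = s) ws)"

lemma word_pull_letter:
  assumes "num_letters s ws > 0"
  obtains x us e where "snd x = s" "word ws = scl e (word (x # us))" "set (x # us) \<subseteq> set ws"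
    "num_letters s ws = Suc (num_letters s us)" "num_letters (other s) ws = num_letters (other s) us"
proof -
  obtain x where x: "x \<in> set ws" "snd x = s"
    using assms by (auto simp: filter_empty_conv)
  then obtain e where e: "word ws = scl e (word (x # remove1 x ws))"
    using word_move_front by blast
  obtain as bs where ws: "ws = as @ x # bs" "x \<notin> set as" using x(1) by (meson split_list_first)
  have "remove1 x ws = as @ bs" using ws by (simp add: remove1_append)
  hence "num_letters s ws = Suc (num_letters s (remove1 x ws))"
    "num_letters (other s) ws = num_letters (other s) (remove1 x ws)"
    "set (x # remove1 x ws) \<subseteq> set ws"
    using ws x(2) by (auto simp: eq_commute[of s])
  thus ?thesis using that x(2) e by blast
qed

lemma num_letters_swap: "num_letters s (map swap_letter ws) = num_letters (other s) ws"
proof -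
  have "other r = s \<longleftrightarrow> r = other s" for r by auto
  thus ?thesis by (simp add: filter_map o_def swap_letter_def)
qed

section \<open>The dimension of a quotient cut out by functionals\<close>

text \<open>
  Dimension is defined by successive line extensions. For \<open>Y \<subseteq> X\<close> let \<open>E Y\<close> be the image in the quotient
  of the elements on which all functionals outside \<open>Y\<close> vanish. Then \<open>E {}\<close> is zero, \<open>E X\<close> is the
  whole quotient, and adding \<open>y\<close> to \<open>Y\<close> extends \<open>E Y\<close> by the line through the dual vector \<open>e y\<close>.
\<close>

lemma dimension_quotient_by_functionals:
  fixes \<phi> :: "'x \<Rightarrow> superpoly \<Rightarrow> complex" and e :: "'x \<Rightarrow> superpoly" and k j :: nat
  defines "R \<equiv> super_ring k j"
  assumes I: "ideal I R" and fin: "finite X"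
    and add: "\<And>x p q. \<phi> x (p + q) = \<phi> x p + \<phi> x q"
    and scl: "\<And>x c p. \<phi> x (scl c p) = c * \<phi> x p"
    and e: "\<And>x. x \<in> X \<Longrightarrow> e x \<in> carrier R"
    and dual: "\<And>x y. x \<in> X \<Longrightarrow> y \<in> X \<Longrightarrow> \<phi> y (e x) = (if x = y then 1 else 0)"
    and ker: "\<And>p. p \<in> I \<longleftrightarrow> p \<in> carrier R \<and> (\<forall>x\<in>X. \<phi> x p = 0)"
  shows "ring.dimension (R Quot I) (card X) {I +>\<^bsub>R\<^esub> super_const c | c. c \<in> UNIV} (carrier (R Quot I))"
proof -
  interpret ideal I R by (rule I)
  interpret Q: ring "R Quot I" by (rule quotient_is_ring)
  define K where "K = {I +>\<^bsub>R\<^esub> super_const c | c. c \<in> UNIV}"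
  define E where "E Y = {I +>\<^bsub>R\<^esub> p | p. p \<in> carrier R \<and> (\<forall>x\<in>X - Y. \<phi> x p = 0)}" for Y
  have ops: "p \<oplus>\<^bsub>R\<^esub> q = p + q" "p \<otimes>\<^bsub>R\<^esub> q = p \<star> q" for p q by (simp_all add: R_def)
  have closed: "p \<in> carrier R \<Longrightarrow> q \<in> carrier R \<Longrightarrow> p + q \<in> carrier R"
    "p \<in> carrier R \<Longrightarrow> q \<in> carrier R \<Longrightarrow> p - q \<in> carrier R"
    "p \<in> carrier R \<Longrightarrow> scl c p \<in> carrier R" "super_const c \<in> carrier R" for p q c
    by (simp_all add: R_def super_add_closed super_diff_closed scl_closed super_const_closed)
  have minus: "p \<ominus>\<^bsub>R\<^esub> q = p - q" if "p \<in> carrier R" "q \<in> carrier R" for p q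
  proof -
    have "\<ominus>\<^bsub>R\<^esub> q = - q"
      using that by (intro minus_equality) (auto simp: R_def super_uminus_closed)
    thus ?thesis using that by (simp add: a_minus_def ops)
  qed
  have coset_eq: "I +>\<^bsub>R\<^esub> p = I +>\<^bsub>R\<^esub> q \<longleftrightarrow> p - q \<in> I" if "p \<in> carrier R" "q \<in> carrier R" for p q
    using quotient_eq_iff_same_a_r_cos[OF I that] minus[OF that] by simp
  have diff: "\<phi> x (p - q) = \<phi> x p - \<phi> x q" for x p q
    using add[of x p "scl (-1) q"] scl[of x "-1" q] by (simp add: scl_minus)
  have lin: "(I +>\<^bsub>R\<^esub> super_const c) \<otimes>\<^bsub>R Quot I\<^esub> (I +>\<^bsub>R\<^esub> p) \<oplus>\<^bsub>R Quot I\<^esub> (I +>\<^bsub>R\<^esub> q)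
      = I +>\<^bsub>R\<^esub> (scl c p + q)" if "p \<in> carrier R" "q \<in> carrier R" for c p q
    using that closed(4)[of c] closed(3)[of p c]
    by (simp add: FactRing_def rcoset_mult_add a_rcos_sum ops scl_def)
  have carrierQ: "carrier (R Quot I) = E X"
    unfolding FactRing_def E_def A_RCOSETS_def' by auto
  have "Q.dimension (card Y) K (E Y)" if "Y \<subseteq> X" for Y
    using finite_subset[OF that fin] that
  proof (induction Y rule: finite_induct)
    case empty
    have "E {} = {I}"
    proof -
      have "I +>\<^bsub>R\<^esub> p = I" if "p \<in> I" for p using that by (rule a_rcos_const)
      hence "I +>\<^bsub>R\<^esub> p = I" if "p \<in> carrier R" "\<forall>x\<in>X. \<phi> x p = 0" for p using that ker by blast
      moreover have "0 \<in> carrier R" "\<forall>x\<in>X. \<phi> x 0 = 0"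
        using super_zero_closed scl[of _ 0 0] by (simp_all add: R_def)
      ultimately show ?thesis unfolding E_def by auto
    qed
    thus ?case using Q.zero_dim[of K] by (simp add: FactRing_def)
  next
    case (insert y Y)
    hence y: "y \<in> X" "Y \<subseteq> X" "y \<notin> Y" by auto
    let ?v = "I +>\<^bsub>R\<^esub> e y"
    have v: "?v \<in> carrier (R Quot I)"
      using e[OF y(1)] unfolding FactRing_def A_RCOSETS_def' by auto
    have "?v \<notin> E Y"
    proof
      assume "?v \<in> E Y"
      then obtain p where p: "p \<in> carrier R" "\<forall>x\<in>X - Y. \<phi> x p = 0" "?v = I +>\<^bsub>R\<^esub> p"
        by (auto simp: E_def)
      hence "e y - p \<in> I" using coset_eq e[OF y(1)] by blast
      hence "\<phi> y (e y - p) = 0" using ker y(1) by blast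
      thus False using p(2) y dual[of y y] by (simp add: diff)
    qed
    moreover have "Q.dimension (card Y) K (E Y)" using insert by auto
    ultimately have "Q.dimension (Suc (card Y)) K (Q.line_extension K ?v (E Y))"
      by (rule Q.Suc_dim[OF v])
    moreover have "Q.line_extension K ?v (E Y) = E (insert y Y)"
    proof (intro equalityI subsetI)
      fix u assume "u \<in> Q.line_extension K ?v (E Y)"
      then obtain a b where ab: "a \<in> K" "b \<in> E Y"
        and u': "u = a \<otimes>\<^bsub>R Quot I\<^esub> ?v \<oplus>\<^bsub>R Quot I\<^esub> b"
        unfolding Q.line_extension_mem_iff by (elim bexE)
      obtain c where c: "a = I +>\<^bsub>R\<^esub> super_const c" using ab(1) by (auto simp only: K_def)
      obtain p where p: "p \<in> carrier R" "\<forall>x\<in>X - Y. \<phi> x p = 0" and b: "b = I +>\<^bsub>R\<^esub> p"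
        using ab(2) by (auto simp only: E_def)
      have u: "u = (I +>\<^bsub>R\<^esub> super_const c) \<otimes>\<^bsub>R Quot I\<^esub> ?v \<oplus>\<^bsub>R Quot I\<^esub> (I +>\<^bsub>R\<^esub> p)"
        using u' unfolding c b .
      have "u = I +>\<^bsub>R\<^esub> (scl c (e y) + p)" unfolding u by (rule lin[OF e[OF y(1)] p(1)])
      moreover have "scl c (e y) + p \<in> carrier R" 
        by (rule closed(1)[OF closed(3)[OF e[OF y(1)]] p(1)])
      moreover have "\<forall>x\<in>X - insert y Y. \<phi> x (scl c (e y) + p) = 0"
        using p(2) y(1) dual[of y] by (auto simp: add scl)
      ultimately show "u \<in> E (insert y Y)" by (auto simp only: E_def)
    next
      fix u assume "u \<in> E (insert y Y)"
      then obtain p where p: "p \<in> carrier R" "\<forall>x\<in>X - insert y Y. \<phi> x p = 0" "u = I +>\<^bsub>R\<^esub> p"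
        by (auto simp only: E_def)
      define q where "q = p - scl (\<phi> y p) (e y)"
      have q: "q \<in> carrier R" 
        unfolding q_def by (rule closed(2)[OF p(1) closed(3)[OF e[OF y(1)]]])
      have "\<phi> x q = 0" if "x \<in> X - Y" for x
        using that p(2) y(1) dual[of y x] by (cases "x = y") (auto simp: q_def diff scl)
      hence "I +>\<^bsub>R\<^esub> q \<in> E Y" using q by (auto simp only: E_def)
      moreover have "u = (I +>\<^bsub>R\<^esub> super_const (\<phi> y p)) \<otimes>\<^bsub>R Quot I\<^esub> ?v \<oplus>\<^bsub>R Quot I\<^esub> (I +>\<^bsub>R\<^esub> q)"
        unfolding p(3) lin[OF e[OF y(1)] q] by (simp add: q_def)
      ultimately show "u \<in> Q.line_extension K ?v (E Y)"
        unfolding Q.line_extension_mem_iff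
        by (intro bexI[of _ "I +>\<^bsub>R\<^esub> super_const (\<phi> y p)"] bexI[of _ "I +>\<^bsub>R\<^esub> q"])
          (auto simp only: K_def)
    qed
    ultimately show ?case using insert by simp
  qed
  thus ?thesis unfolding carrierQ K_def by simp
qed

section \<open>Counting monomials\<close>

text \<open>
  Listing the exponents along an enumeration of \<open>A\<close> turns exponent functions into lists of length
  \<open>card A\<close> with sum \<open>d\<close>.
\<close>

lemma card_exponents:
  assumes "finite A"
  shows "card {m :: 'a \<Rightarrow>\<^sub>0 nat. psupp m \<subseteq> A \<and> (\<Sum>v\<in>A. pcoeff m v) = d} = (card A + d - 1) choose d"
    and "finite {m :: 'a \<Rightarrow>\<^sub>0 nat. psupp m \<subseteq> A \<and> (\<Sum>v\<in>A. pcoeff m v) = d}"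
proof -
  let ?M = "{m :: 'a \<Rightarrow>\<^sub>0 nat. psupp m \<subseteq> A \<and> (\<Sum>v\<in>A. pcoeff m v) = d}"
  let ?L = "{l :: nat list. length l = card A \<and> sum_list l = d}"
  obtain xs where xs: "set xs = A" "distinct xs" using finite_distinct_list[OF assms] by blast
  hence len: "length xs = card A" using distinct_card by metis
  let ?f = "\<lambda>m. map (pcoeff m) xs"
  have "bij_betw ?f ?M ?L"
  proof (rule bij_betw_imageI)
    show "inj_on ?f ?M"
    proof (rule inj_onI)
      fix m m' assume "m \<in> ?M" "m' \<in> ?M" and eq: "?f m = ?f m'"
      hence "psupp m \<subseteq> A" "psupp m' \<subseteq> A" by auto
      moreover have "pcoeff m v = pcoeff m' v" if "v \<in> A" for v using eq that xs by simp
      ultimately show "m = m'" by (intro poly_mapping_eqI) (metis in_keys_iff subsetD)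
    qed
    show "?f ` ?M = ?L"
    proof (intro equalityI subsetI)
      fix l assume "l \<in> ?f ` ?M"
      thus "l \<in> ?L" using xs len by (auto simp: sum_list_distinct_conv_sum_set)
    next
      fix l assume l: "l \<in> ?L"
      define m where "m = (\<Sum>i<length xs. psingle (xs ! i) (l ! i))"
      have m: "pcoeff m v = (\<Sum>i<length xs. if xs ! i = v then l ! i else 0)" for v
        by (simp add: m_def lookup_sum lookup_single when_def)
      have nth: "pcoeff m (xs ! i) = l ! i" if "i < length xs" for i
      proof -
        have "pcoeff m (xs ! i) = (\<Sum>i'<length xs. if i' = i then l ! i' else 0)"
          unfolding m using xs(2) that by (intro sum.cong) (auto simp: nth_eq_iff_index_eq)
        thus ?thesis using that by simp
      qed
      have f: "?f m = l" using l len nth by (intro nth_equalityI) auto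
      have "psupp m \<subseteq> A"
      proof
        fix v assume "v \<in> psupp m"
        hence "(\<Sum>i<length xs. if xs ! i = v then l ! i else 0) \<noteq> 0" by (simp add: in_keys_iff m)
        then obtain i where "i < length xs" "xs ! i = v"
          by (elim sum.not_neutral_contains_not_neutral) (auto split: if_splits)
        thus "v \<in> A" using xs(1) by auto
      qed
      moreover have "(\<Sum>v\<in>A. pcoeff m v) = d"
        using sum_list_distinct_conv_sum_set[OF xs(2), of "pcoeff m"] l unfolding f xs(1) by simp
      ultimately show "l \<in> ?f ` ?M" using f by blast
    qed
  qed
  moreover have "card ?L = (card A + d - 1) choose d"
    by (simp add: card_length_sum_list add.commute)
  moreover have "finite ?L"
    by (rule finite_subset[OF _ finite_lists_length_eq[of "{..d}" "card A"]])
       (auto intro: member_le_sum_list)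
  ultimately show "card ?M = (card A + d - 1) choose d" "finite ?M"
    using bij_betw_same_card[of ?f ?M ?L] bij_betw_finite[of ?f ?M ?L] by auto
qed

definition mons_deg :: "nat \<Rightarrow> nat \<Rightarrow> nat \<times> nat \<Rightarrow> mon set" where
  "mons_deg k j x = {M \<in> mons k j. bidegree M = x}"

lemma two_cases: "(s :: 2) \<noteq> 2 \<longleftrightarrow> s = 1" "(s :: 2) \<noteq> 1 \<longleftrightarrow> s = 2"
  using exhaust_2[of s] by auto

text \<open>
  A monomial without variables of subscript 2 consists of a fermionic set of some size \<open>h\<close> and a
  bosonic monomial of degree \<open>i - h\<close>.
\<close>

lemma mons_deg_pure: "mons_deg k j (i, 0) = (\<Union>h\<in>{0..i}.
    {m. psupp m \<subseteq> {1..k} \<times> {1} \<and> (\<Sum>v\<in>{1..k} \<times> {1}. pcoeff m v) = i - h} \<times>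
    {F. F \<subseteq> {1..j} \<times> {1} \<and> card F = h})" (is "_ = ?U")
proof (intro equalityI subsetI)
  fix M assume "M \<in> mons_deg k j (i, 0)"
  hence M: "M \<in> mons k j" "degree_in 1 M = i" "degree_in 2 M = 0"
    by (auto simp: mons_deg_def bidegree_def)
  have fin: "finite (snd M)" using M(1) by (rule mons_finite)
  have "snd v = 1" if "v \<in> psupp (fst M)" for v
  proof (rule ccontr)
    assume "snd v \<noteq> 1"
    hence v: "snd v = 2" by (simp add: two_cases)
    have "exp_degree 2 (fst M) = 0" using M(3) by (simp add: degree_in_def)
    hence "\<forall>w\<in>psupp (fst M). (if snd w = 2 then pcoeff (fst M) w else 0) = 0"
      by (simp add: exp_degree_def)
    from bspec[OF this that] show False using v that by (simp add: in_keys_iff)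
  qed
  hence keys: "psupp (fst M) \<subseteq> {1..k} \<times> {1}" using M(1) by (force simp: mons_def)
  have "{v \<in> snd M. snd v = 2} = {}" using M(3) fin by (simp add: degree_in_def)
  hence one: "snd v = 1" if "v \<in> snd M" for v using that two_cases by blast
  hence F: "snd M \<subseteq> {1..j} \<times> {1}" using M(1) by (force simp: mons_def)
  have "{v \<in> snd M. snd v = 1} = snd M" using one by auto
  moreover have "exp_degree 1 (fst M) = (\<Sum>v\<in>{1..k} \<times> {1}. pcoeff (fst M) v)"
    using keys by (subst exp_degree_over[where A = "{1..k} \<times> {1}"]) (auto intro!: sum.cong)
  ultimately have "(\<Sum>v\<in>{1..k} \<times> {1}. pcoeff (fst M) v) = i - card (snd M)" "card (snd M) \<le> i"
    using M(2) by (auto simp: degree_in_def)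
  thus "M \<in> ?U" using keys F by (cases M) auto
next
  fix M assume "M \<in> ?U"
  then obtain h m F where M: "M = (m, F)" and h: "h \<le> i" and m: "psupp m \<subseteq> {1..k} \<times> {1}"
    "(\<Sum>v\<in>{1..k} \<times> {1}. pcoeff m v) = i - h" and F: "F \<subseteq> {1..j} \<times> {1}" "card F = h"
    by auto
  have "exp_degree 1 m = i - h"
    unfolding m(2)[symmetric] using m(1)
    by (subst exp_degree_over[where A = "{1..k} \<times> {1}"]) (auto intro!: sum.cong)
  moreover have "exp_degree 2 m = 0"
    using m(1) by (subst exp_degree_over[where A = "{1..k} \<times> {1}"]) (auto intro!: sum.neutral)
  moreover have "{v \<in> F. snd v = 1} = F" "{v \<in> F. snd v = 2} = {}" using F(1) by auto
  ultimately have "bidegree M = (i, 0)"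
    using h F(2) by (simp only: M bidegree_def degree_in_def fst_conv snd_conv card.empty
        le_add_diff_inverse2 add_0_left)
  moreover have "M \<in> mons k j" using m(1) F(1) by (force simp: M mons_def)
  ultimately show "M \<in> mons_deg k j (i, 0)" by (simp add: mons_deg_def)
qed

lemma card_mons_deg_pure:
  "card (mons_deg k j (i, 0)) = (\<Sum>h=0..i. (j choose h) * num_monomials k (i - h))"
  "finite (mons_deg k j (i, 0))"
proof -
  let ?E = "\<lambda>h. {m :: var \<Rightarrow>\<^sub>0 nat. psupp m \<subseteq> {1..k} \<times> {1} \<and> (\<Sum>v\<in>{1..k} \<times> {1}. pcoeff m v) = i - h}"
  let ?F = "\<lambda>h. {F :: var set. F \<subseteq> {1..j} \<times> {1} \<and> card F = h}"
  have E: "card (?E h) = num_monomials k (i - h)" "finite (?E h)" for h :: nat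
    using card_exponents[of "{1..k} \<times> {1}" "i - h"] by (auto simp: num_monomials_def card_cartesian_product)
  have F: "card (?F h) = j choose h" "finite (?F h)" for h
    using n_subsets[of "{1..j} \<times> {1}" h] by (auto simp: card_cartesian_product)
  have "card (mons_deg k j (i, 0)) = (\<Sum>h\<in>{0..i}. card (?E h \<times> ?F h))"
    unfolding mons_deg_pure
  proof (rule card_UN_disjoint)
    show "\<forall>h\<in>{0..i}. finite (?E h \<times> ?F h)" using E(2) F(2) by blast
    show "\<forall>h\<in>{0..i}. \<forall>h'\<in>{0..i}. h \<noteq> h' \<longrightarrow> (?E h \<times> ?F h) \<inter> (?E h' \<times> ?F h') = {}" by auto
  qed simp
  thus "card (mons_deg k j (i, 0)) = (\<Sum>h=0..i. (j choose h) * num_monomials k (i - h))"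
    by (simp only: card_cartesian_product E F mult.commute)
  show "finite (mons_deg k j (i, 0))"
    unfolding mons_deg_pure using E(2) F(2) by (intro finite_UN_I finite_cartesian_product) auto
qed

lemma mons_deg_swap: "mons_deg k j (b, a) = swap_mon ` mons_deg k j (a, b)"
proof -
  have sub: "swap_mon ` mons_deg k j (a, b) \<subseteq> mons_deg k j (b, a)" for a b
  proof (rule image_subsetI)
    fix M assume "M \<in> mons_deg k j (a, b)"
    hence M: "M \<in> mons k j" "bidegree M = (a, b)" by (simp_all add: mons_deg_def)
    have "bidegree (swap_mon M) = (b, a)"
      unfolding bidegree_swap_mon[OF mons_finite[OF M(1)]] M(2) by simp
    thus "swap_mon M \<in> mons_deg k j (b, a)"
      using swap_mon_in_mons[OF M(1)] by (simp add: mons_deg_def)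
  qed
  have "swap_mon ` swap_mon ` mons_deg k j (b, a) = mons_deg k j (b, a)"
    by (simp add: image_image)
  thus ?thesis using sub[of a b] image_mono[OF sub[of b a], of swap_mon] by auto
qed

lemma inj_swap_mon: "inj_on swap_mon A"
  by (rule inj_on_inverseI[of _ swap_mon]) simp

lemma mons_deg_zero: "mons_deg k j (0, 0) = {(0, {})}"
proof -
  have "M = (0, {})" if "M \<in> mons_deg k j (0, 0)" for M
    using that bidegree_eq_zero[OF mons_finite[of M k j]] by (simp add: mons_deg_def)
  moreover have "(0, {}) \<in> mons_deg k j (0, 0)"
    by (simp add: mons_deg_def mons_def bidegree_zero)
  ultimately show ?thesis by blast
qed

section \<open>Edge monomials modulo the exchange of subscripts\<close>

text \<open>
  The monomials of bidegree \<open>(1, 1)\<close>. The exchange of subscripts exchanges the two colours.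
\<close>

definition mixed_mon :: "colour \<Rightarrow> colour \<Rightarrow> mon" where
  "mixed_mon c d = content [(c, 1), (d, 2)]"

lemma letters_content: "letters (content ws) = set ws"
proof (induction ws rule: content.induct)
  case (2 a r ws)
  have "psupp (psingle (a, r) 1 + m) = insert (a, r) (psupp m)" for m :: "var \<Rightarrow>\<^sub>0 nat"
    by (auto simp: in_keys_iff lookup_add lookup_single when_def split: if_splits)
  thus ?case using 2 by (simp add: letters_def del: One_nat_def)
qed (auto simp: letters_def)

lemma mixed_mon_inject: "mixed_mon c d = mixed_mon c' d' \<longleftrightarrow> c = c' \<and> d = d'"
proof
  assume "mixed_mon c d = mixed_mon c' d'"
  hence "letters (mixed_mon c d) = letters (mixed_mon c' d')" by simp
  hence "{(c, 1), (d, 2)} = {(c', 1 :: 2), (d', 2)}"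
    by (simp add: mixed_mon_def letters_content del: content.simps)
  thus "c = c' \<and> d = d'" by (auto simp: doubleton_eq_iff)
qed simp

lemma proper_mixed: "proper [(c, 1), (d, 2)]"
  by (cases c; cases d) auto

lemma swap_mixed_mon: "swap_mon (mixed_mon c d) = mixed_mon d c"
proof -
  have "swap_mon (mixed_mon c d) = content [(c, 2), (d, 1)]"
    unfolding mixed_mon_def content_swap[symmetric] by simp
  also have "\<dots> = mixed_mon d c"
    unfolding mixed_mon_def by (cases c; cases d) (auto simp: add_ac)
  finally show ?thesis .
qed

lemma bidegree_mixed_mon: "bidegree (mixed_mon c d) = (1, 1)"
  unfolding mixed_mon_def bidegree_def degree_in_content[OF proper_mixed] by simp

lemma mixed_mon_in_mons: "mixed_mon c d \<in> mons k j \<longleftrightarrow> (c, 1) \<in> range_letters k j \<and> (d, 2) \<in> range_letters k j"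
proof
  assume "mixed_mon c d \<in> mons k j"
  from letters_subset[OF this] show "(c, 1) \<in> range_letters k j \<and> (d, 2) \<in> range_letters k j"
    by (simp add: mixed_mon_def letters_content del: content.simps)
next
  assume "(c, 1) \<in> range_letters k j \<and> (d, 2) \<in> range_letters k j"
  thus "mixed_mon c d \<in> mons k j"
    unfolding mixed_mon_def by (intro content_in_mons) simp
qed

lemma bidegree_1_1_is_mixed_mon:
  assumes "finite (snd M)" "bidegree M = (1, 1)"
  obtains c d where "M = mixed_mon c d"
proof -
  obtain e ws where ws: "proper ws" "content ws = M"
    using smonom_eq_word[OF assms(1)] by metis
  have len: "length (filter (\<lambda>x. snd x = 1) ws) = 1" "length (filter (\<lambda>x. snd x = 2) ws) = 1"
    using degree_in_content[OF ws(1)] assms(2) ws(2) by (simp_all add: bidegree_def)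
  have "filter (\<lambda>x. snd x \<noteq> 1) ws = filter (\<lambda>x. snd x = 2) ws" by (simp add: two_cases)
  hence "length ws = 2"
    using sum_length_filter_compl[of "\<lambda>x. snd x = 1" ws] len by simp
  then obtain x y where xy: "ws = [x, y]"
    by (metis (no_types) One_nat_def Suc_1 length_0_conv length_Suc_conv)
  have "(snd x = 1 \<and> snd y = 2) \<or> (snd x = 2 \<and> snd y = 1)"
    using len exhaust_2[of "snd x"] exhaust_2[of "snd y"] unfolding xy by auto
  thus ?thesis
  proof
    assume "snd x = 1 \<and> snd y = 2"
    hence "M = mixed_mon (fst x) (fst y)"
      unfolding ws(2)[symmetric] xy mixed_mon_def by (metis prod.collapse)
    thus ?thesis by (rule that)
  next
    assume "snd x = 2 \<and> snd y = 1"
    hence "M = content [(fst x, 2), (fst y, 1)]"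
      unfolding ws(2)[symmetric] xy by (metis prod.collapse)
    also have "\<dots> = swap_mon (mixed_mon (fst x) (fst y))"
      unfolding mixed_mon_def content_swap[symmetric] by simp
    finally have "M = mixed_mon (fst y) (fst x)" by (simp only: swap_mixed_mon)
    thus ?thesis by (rule that)
  qed
qed

text \<open>
  The exchange reverses the two factors, and putting them back costs their commutation sign.
\<close>

lemma swap_sign_mixed_mon: "swap_sign (mixed_mon c c) = comm_sign c c"
proof -
  obtain e where e: "e \<in> {1, -1}" "word [(c, 1), (c, 2)] = scl e (smonom (mixed_mon c c))"
    using word_eq_smonom[OF proper_mixed[of c c]] by (auto simp only: mixed_mon_def)
  hence m: "smonom (mixed_mon c c) = scl e (word [(c, 1), (c, 2)])" by (elim insertE) auto
  have "super_act swap_matrix (word [(c, 1), (c, 2)]) = gvar (c, 2) \<star> gvar (c, 1)"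
    unfolding act_swap_word by simp
  also have "\<dots> = scl (comm_sign c c) (word [(c, 1), (c, 2)])"
    using gvar_commute[of "(c, 2)" "(c, 1)"] by simp
  finally have "super_act swap_matrix (smonom (mixed_mon c c)) = scl (comm_sign c c) (smonom (mixed_mon c c))"
    by (simp only: m super_act_scl scl_simps mult.commute)
  thus ?thesis by (simp add: swap_sign_def swap_mixed_mon coef_smonom)
qed

text \<open>
  One order of each pair of distinct colours, bosonic colours first. A fermionic colour is also
  paired with itself, as the product of its two variables is anti-invariant under the exchange of
  subscripts, but a bosonic colour is not, as that product is invariant.
\<close>

definition colour_pairs :: "nat \<Rightarrow> nat \<Rightarrow> (colour \<times> colour) set" where
  "colour_pairs k j =
     (\<lambda>(p, q). (Inl p, Inl q)) ` {(p, q). p \<in> {1..k} \<and> q \<in> {1..k} \<and> p < q} \<union>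
     (\<lambda>(p, q). (Inl p, Inr q)) ` ({1..k} \<times> {1..j}) \<union>
     (\<lambda>(p, q). (Inr p, Inr q)) ` {(p, q). p \<in> {1..j} \<and> q \<in> {1..j} \<and> p \<le> q}"

lemma card_less_pairs: "card {(p, q). p \<in> {1..k} \<and> q \<in> {1..k} \<and> p < q} = k choose 2" for k :: nat
proof -
  have "{(p, q). p \<in> {1..k} \<and> q \<in> {1..k} \<and> p < q} = (SIGMA q:{1..k}. {1..<q})\<inverse>"
    by auto
  also have "card \<dots> = (\<Sum>q\<in>{1..k}. card {1..<q})"
    by (subst card_inverse) (simp add: card_SigmaI)
  also have "\<dots> = k choose 2"
    by (induction k) (simp_all add: numeral_2_eq_2)
  finally show ?thesis .
qed

lemma card_le_pairs: "card {(p, q). p \<in> {1..j} \<and> q \<in> {1..j} \<and> p \<le> q} = (j + 1) choose 2" for j :: nat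
proof -
  have "{(p, q). p \<in> {1..j} \<and> q \<in> {1..j} \<and> p \<le> q} = (SIGMA q:{1..j}. {1..q})\<inverse>"
    by auto
  also have "card \<dots> = (\<Sum>q\<in>{1..j}. card {1..q})"
    by (subst card_inverse) (simp add: card_SigmaI)
  also have "\<dots> = (j + 1) choose 2"
    by (induction j) (simp_all add: numeral_2_eq_2)
  finally show ?thesis .
qed

lemma card_colour_pairs: "card (colour_pairs k j) = (k choose 2) + k * j + ((j + 1) choose 2)"
  and finite_colour_pairs: "finite (colour_pairs k j)"
proof -
  let ?A = "{(p, q). p \<in> {1..k} \<and> q \<in> {1..k} \<and> p < q}"
  let ?B = "{1..k} \<times> {1..j}"
  let ?C = "{(p, q). p \<in> {1..j} \<and> q \<in> {1..j} \<and> p \<le> q}"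
  have fin: "finite ?A" "finite ?B" "finite ?C"
    by (rule finite_subset[of _ "{1..k} \<times> {1..k}"], auto, rule finite_subset[of _ "{1..j} \<times> {1..j}"], auto)
  thus "finite (colour_pairs k j)" unfolding colour_pairs_def by simp
  have inj: "inj_on (\<lambda>(p, q). (Inl p :: colour, Inl q :: colour)) ?A"
    "inj_on (\<lambda>(p, q). (Inl p :: colour, Inr q :: colour)) ?B"
    "inj_on (\<lambda>(p, q). (Inr p :: colour, Inr q :: colour)) ?C"
    by (auto simp: inj_on_def)
  have "card (colour_pairs k j) = card ?A + card ?B + card ?C"
    unfolding colour_pairs_def using fin
    by (subst card_Un_disjoint, simp, simp, force, subst card_Un_disjoint, simp, simp, force)
      (simp only: card_image[OF inj(1)] card_image[OF inj(2)] card_image[OF inj(3)])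
  thus "card (colour_pairs k j) = (k choose 2) + k * j + ((j + 1) choose 2)"
    unfolding card_less_pairs card_le_pairs by (simp add: card_cartesian_product)
qed

text \<open>
  Representatives of the orbits of the exchange on the monomials of edge bidegree, without the
  orbits on which there is no anti-invariant.
\<close>

definition edge_reps :: "nat \<Rightarrow> nat \<Rightarrow> nat \<Rightarrow> mon set" where
  "edge_reps n k j = mons_deg k j (n, 0) \<union> (\<lambda>(c, d). mixed_mon c d) ` colour_pairs k j"

lemma colour_pairs_in_range:
  "(c, d) \<in> colour_pairs k j \<Longrightarrow> (c, r) \<in> range_letters k j \<and> (d, s) \<in> range_letters k j"
  by (auto simp: colour_pairs_def range_letters_def)

lemma colour_pairs_antisym:
  "(c, d) \<in> colour_pairs k j \<Longrightarrow> (d, c) \<in> colour_pairs k j \<Longrightarrow> c = d \<and> comm_sign c d = -1"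
  by (auto simp: colour_pairs_def comm_sign_def)

lemma colour_pairs_total:
  assumes "(c, r) \<in> range_letters k j" "(d, s) \<in> range_letters k j"
  shows "(c, d) \<in> colour_pairs k j \<or> (d, c) \<in> colour_pairs k j \<or> c = d \<and> comm_sign c d = 1"
  using assms by (cases c; cases d) (auto simp: colour_pairs_def range_letters_def comm_sign_def image_iff)

section \<open>The coinvariant ideal as a kernel\<close>

context
  fixes n k j :: nat
  assumes n_ge_2: "n \<ge> 2"
begin

definition positive_invariants :: "superpoly set" where
  "positive_invariants = {f \<in> dihedral_invariants n k j. constant_term f = 0}"

lemma coinvariant_ideal_eq: "coinvariant_ideal n k j = Idl\<^bsub>super_ring k j\<^esub> positive_invariants"
  by (simp add: coinvariant_ideal_def positive_invariants_def)

lemma positive_invariants_subset: "positive_invariants \<subseteq> carrier (super_ring k j)"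
  by (auto simp: positive_invariants_def dihedral_invariants_def)

lemma ideal_coinvariant: "ideal (coinvariant_ideal n k j) (super_ring k j)"
  unfolding coinvariant_ideal_eq
  by (rule ring.genideal_ideal[OF ring_super_ring positive_invariants_subset])

definition zeta :: complex where "zeta = cis (2 * pi / real n)"

lemma zeta_power: "zeta ^ n = 1" "zeta \<noteq> 0"
  using n_ge_2 by (simp_all add: zeta_def DeMoivre)

lemma zeta_power_neq_1:
  assumes "0 < i" "i < n"
  shows "zeta ^ i \<noteq> 1"
proof -
  have "inj_on (\<lambda>k. cis (2 * pi * real k / real n)) {..<n}"
    using bij_betw_roots_unity[of n] n_ge_2 by (auto simp: bij_betw_def)
  from inj_onD[OF this, of i 0] have "cis (2 * pi * real i / real n) \<noteq> 1"
    using assms by auto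
  thus ?thesis by (simp add: zeta_def DeMoivre mult_ac)
qed

abbreviation rot :: "complex^2^2" where "rot \<equiv> diag_matrix (inverse zeta) zeta"

lemma rotation_zeta: "dihedral_rotation n ** eigenbasis = eigenbasis ** rot"
  unfolding rotation_eigenbasis zeta_def by (simp add: cis_inverse)

text \<open>
  The positive invariants in eigencoordinates. Two matrices suffice, since the rotation and the
  reflection generate the group.
\<close>

definition eigen_invariants :: "superpoly set" where
  "eigen_invariants = {p \<in> carrier (super_ring k j). super_act swap_matrix p = p \<and> super_act rot p = p \<and>
     coef p (0, {}) = 0}"

lemma eigen_invariants_to_positive:
  assumes "p \<in> eigen_invariants"
  shows "super_act eigenbasis p \<in> positive_invariants"
proof -
  have p: "p \<in> carrier (super_ring k j)" "super_act swap_matrix p = p" "super_act rot p = p" "coef p (0, {}) = 0"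
    and fin: "fin p"
    using assms carrier_fin by (auto simp: eigen_invariants_def)
  have "super_act (dihedral_rotation n) (super_act eigenbasis p) = super_act eigenbasis p"
    using act_conjugate[OF fin rotation_zeta] unfolding p(3) .
  moreover have "super_act dihedral_reflection (super_act eigenbasis p) = super_act eigenbasis p"
    using act_conjugate[OF fin reflection_eigenbasis] unfolding p(2) .
  ultimately have "super_act g (super_act eigenbasis p) = super_act eigenbasis p" if "g \<in> dihedral_group n" for g
    using dihedral_group_fixes[OF fin_super_act _ _ that] by blast
  hence "super_act eigenbasis p \<in> dihedral_invariants n k j"
    using super_act_closed[OF p(1)] by (simp add: dihedral_invariants_def)
  moreover have "constant_term (super_act eigenbasis p) = 0"
    using p(4) coef_super_act_zero[OF fin, of eigenbasis]
    unfolding constant_term_def coef_def by simp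
  ultimately show ?thesis by (simp add: positive_invariants_def)
qed

lemma positive_invariants_to_eigen:
  assumes "f \<in> positive_invariants"
  shows "super_act eigenbasis_inv f \<in> eigen_invariants"
proof -
  define p where "p = super_act eigenbasis_inv f"
  have f: "f \<in> carrier (super_ring k j)" "\<And>g. g \<in> dihedral_group n \<Longrightarrow> super_act g f = f" "constant_term f = 0"
    using assms by (auto simp: positive_invariants_def dihedral_invariants_def)
  have fin: "fin f" "fin p" using f(1) carrier_fin by (auto simp: p_def)
  have fp: "f = super_act eigenbasis p" using fin by (simp add: p_def act_eigenbasis_cancel)
  have gen: "dihedral_rotation n \<in> dihedral_group n" "dihedral_reflection \<in> dihedral_group n"
    by (auto simp: dihedral_group_def intro: generate.incl)
  have cancel: "super_act h p = p"
    if "super_act g f = f" "g ** eigenbasis = eigenbasis ** h" for g h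
  proof -
    have "super_act eigenbasis (super_act h p) = super_act eigenbasis p"
      using act_conjugate[OF fin(2) that(2)] that(1) fp by simp
    hence "super_act eigenbasis_inv (super_act eigenbasis (super_act h p))
        = super_act eigenbasis_inv (super_act eigenbasis p)" by simp
    thus ?thesis using fin by (simp add: act_eigenbasis_cancel)
  qed
  have "super_act swap_matrix p = p" "super_act rot p = p"
    using cancel f(2) gen rotation_zeta reflection_eigenbasis by blast+
  moreover have "coef p (0, {}) = 0"
    using f(3) coef_super_act_zero[OF fin(1), of eigenbasis_inv]
    unfolding p_def constant_term_def coef_def by simp
  ultimately show ?thesis
    using f(1) by (simp add: eigen_invariants_def p_def super_act_closed)
qed

text \<open>
  The bidegrees in which the ideal is zero, and those in which it consists of the elements fixed
  by the exchange of subscripts; it contains every element of any other bidegree.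
\<close>

definition small_degs :: "(nat \<times> nat) set" where
  "small_degs = {(a, b). (a = 0 \<or> b = 0) \<and> a + b < n}"

definition edge_degs :: "(nat \<times> nat) set" where
  "edge_degs = {(1, 1), (n, 0), (0, n)}"

text \<open>
  The ideal in eigencoordinates, described by linear conditions on coefficients.
\<close>

definition eigen_kernel :: "superpoly set" where
  "eigen_kernel = {p \<in> carrier (super_ring k j).
     (\<forall>M. bidegree M \<in> small_degs \<longrightarrow> coef p M = 0) \<and>
     (\<forall>M. bidegree M \<in> edge_degs \<longrightarrow> coef (p - super_act swap_matrix p) M = 0)}"

lemma swap_degs: "prod.swap ` small_degs = small_degs" "prod.swap ` edge_degs = edge_degs"
  by (auto simp: small_degs_def edge_degs_def image_iff)

lemma high_in_kernel:
  assumes "p \<in> carrier (super_ring k j)" "degs p \<inter> (small_degs \<union> edge_degs) = {}"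
  shows "p \<in> eigen_kernel"
proof -
  have "degs (super_act swap_matrix p) \<inter> (small_degs \<union> edge_degs) = {}"
    by (rule degs_act_swap_disjoint[OF carrier_fin[OF assms(1)] assms(2)])
       (simp add: image_Un swap_degs)
  thus ?thesis using assms unfolding eigen_kernel_def coef_zero_iff_degs[symmetric] by auto
qed

lemma kernel_add: "p \<in> eigen_kernel \<Longrightarrow> q \<in> eigen_kernel \<Longrightarrow> p + q \<in> eigen_kernel"
  by (auto simp: eigen_kernel_def super_add_closed super_act_add add_diff_add)

lemma kernel_scl: "p \<in> eigen_kernel \<Longrightarrow> scl c p \<in> eigen_kernel"
  by (auto simp: eigen_kernel_def scl_closed super_act_scl)

lemma kernel_zero: "0 \<in> eigen_kernel"
  by (simp add: eigen_kernel_def super_zero_closed)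

text \<open>
  An element of the kernel has no component of small bidegree. A positive bidegree added to a
  bidegree that is not small gives one that is neither small nor edge, and there the kernel imposes
  no condition.
\<close>

lemma kernel_mult_positive:
  assumes p: "p \<in> eigen_kernel" and q: "q \<in> carrier (super_ring k j)" "(0, 0) \<notin> degs q"
  shows "p \<star> q \<in> eigen_kernel" "q \<star> p \<in> eigen_kernel"
proof -
  have pS: "p \<in> carrier (super_ring k j)" using p by (simp add: eigen_kernel_def)
  have dp: "degs p \<inter> small_degs = {}"
    using p unfolding eigen_kernel_def coef_zero_iff_degs by simp
  have high: "(a + c, b + d) \<notin> small_degs \<union> edge_degs" "(c + a, d + b) \<notin> small_degs \<union> edge_degs"
    if "(a, b) \<in> degs p" "(c, d) \<in> degs q" for a b c d
  proof -
    have "(a, b) \<notin> small_degs" "(c, d) \<noteq> (0, 0)" using that dp q(2) by auto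
    hence "a \<ge> 1 \<and> b \<ge> 1 \<or> a + b \<ge> n" and pos: "c + d \<ge> 1"
      by (auto simp: small_degs_def)
    thus notin: "(a + c, b + d) \<notin> small_degs \<union> edge_degs"
    proof (elim disjE)
      assume "a \<ge> 1 \<and> b \<ge> 1"
      thus ?thesis using pos by (auto simp: small_degs_def edge_degs_def)
    next
      assume "a + b \<ge> n"
      hence "(a + c) + (b + d) > n" using pos by simp
      thus ?thesis using n_ge_2 by (auto simp: small_degs_def edge_degs_def)
    qed
    from notin show "(c + a, d + b) \<notin> small_degs \<union> edge_degs" by (simp add: add.commute)
  qed
  show "p \<star> q \<in> eigen_kernel"
  proof (rule high_in_kernel)
    show "degs (p \<star> q) \<inter> (small_degs \<union> edge_degs) = {}"
      using degs_mult[of p q] carrier_fin[OF pS] carrier_fin[OF q(1)] high(1) by blast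
  qed (use pS q super_mult_closed in auto)
  show "q \<star> p \<in> eigen_kernel"
  proof (rule high_in_kernel)
    show "degs (q \<star> p) \<inter> (small_degs \<union> edge_degs) = {}"
      using degs_mult[of q p] carrier_fin[OF pS] carrier_fin[OF q(1)] high(2) by blast
  qed (use pS q super_mult_closed in auto)
qed

lemma kernel_mult:
  assumes p: "p \<in> eigen_kernel" and q: "q \<in> carrier (super_ring k j)"
  shows "p \<star> q \<in> eigen_kernel" "q \<star> p \<in> eigen_kernel"
proof -
  \<comment> \<open>The constant term acts as a scalar, and the rest of \<open>q\<close> has positive degree.\<close>
  define c where "c = coef q (0, {})"
  define q' where "q' = q - scl c sone"
  have qSR: "q' \<in> carrier (super_ring k j)" using q by (simp add: q'_def super_diff_closed scl_closed sone_closed)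
  have "coef q' M = 0" if "bidegree M = (0, 0)" for M
  proof (cases "finite (snd M)")
    case True
    hence "M = (0, {})" using that by (rule bidegree_eq_zero)
    thus ?thesis by (simp add: q'_def c_def coef_smonom flip: smonom_one)
  next
    case False
    with carrier_fin[OF qSR] show ?thesis by (rule coef_infinite)
  qed
  hence "(0, 0) \<notin> degs q'" by (auto simp: degs_def supp_def)
  from kernel_mult_positive[OF p qSR this]
  have "p \<star> q' + scl c p \<in> eigen_kernel" "q' \<star> p + scl c p \<in> eigen_kernel"
    using p by (auto intro: kernel_add kernel_scl)
  moreover have "q = q' + scl c sone" by (simp add: q'_def)
  ultimately show "p \<star> q \<in> eigen_kernel" "q \<star> p \<in> eigen_kernel"
    by (simp_all add: super_mult_add_left super_mult_add_right scl_mult_left scl_mult_right)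
qed

text \<open>
  The rotation multiplies a monomial of bidegree \<open>(a, b)\<close> by \<open>zeta\<close> to the power \<open>b - a\<close>, which
  differs from 1 in the small bidegrees other than \<open>(0, 0)\<close>.
\<close>

lemma eigen_invariants_subset_kernel: "eigen_invariants \<subseteq> eigen_kernel"
proof
  fix p assume p: "p \<in> eigen_invariants"
  hence fin: "fin p" using carrier_fin by (auto simp: eigen_invariants_def)
  have "coef p M = 0" if M: "bidegree M \<in> small_degs" for M
  proof (cases "finite (snd M)")
    case False
    with fin show ?thesis by (rule coef_infinite)
  next
    case True
    obtain a b where ab: "bidegree M = (a, b)" "a = 0 \<or> b = 0" "a + b < n"
      using M by (auto simp: small_degs_def)
    show ?thesis
    proof (cases "a + b = 0")
      case True
      hence "M = (0, {})" using ab bidegree_eq_zero[OF \<open>finite (snd M)\<close>] by simp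
      thus ?thesis using p by (simp add: eigen_invariants_def)
    next
      case False
      have "coef p M = inverse zeta ^ a * zeta ^ b * coef p M"
        using coef_act_diag[OF fin, of "inverse zeta" zeta M] p ab(1)
        by (simp add: eigen_invariants_def bidegree_def)
      moreover have "zeta ^ a \<noteq> 1 \<or> a = 0" "zeta ^ b \<noteq> 1 \<or> b = 0"
        using zeta_power_neq_1[of a] zeta_power_neq_1[of b] ab by auto
      ultimately show ?thesis using ab(2) False zeta_power(2) by (auto simp: power_inverse)
    qed
  qed
  thus "p \<in> eigen_kernel" using p by (auto simp: eigen_kernel_def eigen_invariants_def)
qed

text \<open>
  The right-hand side is an ideal, the preimage of the kernel under an automorphism, and it contains
  the generators.
\<close>

lemma coinvariant_ideal_subset:
  "coinvariant_ideal n k j \<subseteq> {f \<in> carrier (super_ring k j). super_act eigenbasis_inv f \<in> eigen_kernel}" (is "_ \<subseteq> ?J")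
proof -
  have "ideal ?J (super_ring k j)"
  proof (rule idealI[OF ring_super_ring])
    have neg: "- x \<in> eigen_kernel" if "x \<in> eigen_kernel" for x
      using kernel_scl[OF that, of "-1"] by (simp add: scl_minus)
    interpret ring "super_ring k j" by (rule ring_super_ring)
    have minus: "\<ominus>\<^bsub>super_ring k j\<^esub> x = - x" if "x \<in> carrier (super_ring k j)" for x
      using that by (intro minus_equality) (auto simp: super_uminus_closed)
    show "subgroup ?J (add_monoid (super_ring k j))"
    proof (rule group.subgroupI)
      show "group (add_monoid (super_ring k j))" by (rule add.is_group)
      show "?J \<noteq> {}" using kernel_zero super_zero_closed by (auto intro: exI[of _ 0])
      fix a assume a: "a \<in> ?J"
      have "m_inv (add_monoid (super_ring k j)) a = - a" using minus[of a] a by (simp add: a_inv_def)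
      thus "m_inv (add_monoid (super_ring k j)) a \<in> ?J" using a by (simp add: neg super_uminus_closed super_act_minus)
    next
      fix a b assume "a \<in> ?J" "b \<in> ?J"
      thus "a \<otimes>\<^bsub>add_monoid (super_ring k j)\<^esub> b \<in> ?J" by (simp add: super_add_closed super_act_add kernel_add)
    qed auto
  next
    fix a x assume ax: "a \<in> ?J" "x \<in> carrier (super_ring k j)"
    thus "x \<otimes>\<^bsub>super_ring k j\<^esub> a \<in> ?J" "a \<otimes>\<^bsub>super_ring k j\<^esub> x \<in> ?J"
      using carrier_fin[of a k j] carrier_fin[of x k j]
      by (auto simp: super_mult_closed super_act_mult kernel_mult super_act_closed)
  qed
  moreover have "positive_invariants \<subseteq> ?J"
    using positive_invariants_to_eigen eigen_invariants_subset_kernel positive_invariants_subset by blast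
  ultimately show ?thesis
    unfolding coinvariant_ideal_eq by (rule ring.genideal_minimal[OF ring_super_ring])
qed

text \<open>
  The coinvariant ideal in eigencoordinates; it turns out to be \<open>eigen_kernel\<close>.
\<close>

definition eigen_ideal :: "superpoly set" where
  "eigen_ideal = {p \<in> carrier (super_ring k j). super_act eigenbasis p \<in> coinvariant_ideal n k j}"

lemma eigen_ideal_add: "p \<in> eigen_ideal \<Longrightarrow> q \<in> eigen_ideal \<Longrightarrow> p + q \<in> eigen_ideal"
  using additive_subgroup.a_closed[OF ideal.axioms(1)[OF ideal_coinvariant],
      of "super_act eigenbasis p" "super_act eigenbasis q"]
  by (simp add: eigen_ideal_def super_add_closed super_act_add)

lemma eigen_ideal_mult:
  assumes "p \<in> eigen_ideal" "q \<in> carrier (super_ring k j)"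
  shows "p \<star> q \<in> eigen_ideal" "q \<star> p \<in> eigen_ideal"
  using assms carrier_fin[of p k j] carrier_fin[of q k j]
    ideal.I_l_closed[OF ideal_coinvariant, of "super_act eigenbasis p" "super_act eigenbasis q"]
    ideal.I_r_closed[OF ideal_coinvariant, of "super_act eigenbasis p" "super_act eigenbasis q"]
  by (auto simp: eigen_ideal_def super_mult_closed super_act_mult super_act_closed)

lemma eigen_ideal_scl: "p \<in> eigen_ideal \<Longrightarrow> scl c p \<in> eigen_ideal"
  unfolding scl_def by (intro eigen_ideal_mult super_const_closed)

lemma eigen_ideal_diff: "p \<in> eigen_ideal \<Longrightarrow> q \<in> eigen_ideal \<Longrightarrow> p - q \<in> eigen_ideal"
  using eigen_ideal_add[of p "scl (-1) q"] eigen_ideal_scl[of q "-1"] by (simp add: scl_minus)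

lemma eigen_ideal_zero: "0 \<in> eigen_ideal"
  using additive_subgroup.zero_closed[OF ideal.axioms(1)[OF ideal_coinvariant]]
  by (simp add: eigen_ideal_def super_zero_closed)

lemma eigen_ideal_sum: "(\<And>x. x \<in> A \<Longrightarrow> f x \<in> eigen_ideal) \<Longrightarrow> sum f A \<in> eigen_ideal"
  by (induction A rule: infinite_finite_induct) (auto intro: eigen_ideal_add eigen_ideal_zero)

lemma eigen_invariants_subset_ideal: "eigen_invariants \<subseteq> eigen_ideal"
proof
  fix p assume p: "p \<in> eigen_invariants"
  hence "super_act eigenbasis p \<in> coinvariant_ideal n k j"
    using eigen_invariants_to_positive ring.genideal_self[OF ring_super_ring positive_invariants_subset]
    unfolding coinvariant_ideal_eq by blast
  thus "p \<in> eigen_ideal" using p by (simp add: eigen_ideal_def eigen_invariants_def)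
qed

abbreviation L :: "letter set" where "L \<equiv> range_letters k j"

text \<open>
  The sum is fixed by the exchange, and by the rotation because the edge bidegrees are balanced
  modulo \<open>n\<close>.
\<close>

lemma word_symmetrised_in_ideal:
  assumes ws: "set ws \<subseteq> L" and deg: "(num_letters 1 ws, num_letters 2 ws) \<in> edge_degs"
  shows "word ws + word (map swap_letter ws) \<in> eigen_ideal"
proof -
  let ?p = "word ws + word (map swap_letter ws)"
  have sl: "set (map swap_letter ws) \<subseteq> L"
    using ws range_letters_iff by (fastforce simp: swap_letter_def)
  have "swap_letter \<circ> swap_letter = id" by (auto simp: swap_letter_def)
  hence swap: "super_act swap_matrix ?p = ?p"
    by (simp add: super_act_add act_swap_word add.commute)
  have rot: "super_act rot (word us) = word us"
    if "(num_letters 1 us, num_letters 2 us) \<in> edge_degs" for us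
    using that zeta_power unfolding act_diag_word
    by (auto simp: edge_degs_def power_inverse)
  have "(num_letters 1 (map swap_letter ws), num_letters 2 (map swap_letter ws)) \<in> edge_degs"
    using deg unfolding num_letters_swap by (auto simp: edge_degs_def)
  hence "super_act rot ?p = ?p"
    using rot[OF deg] rot by (simp only: super_act_add)
  moreover have "ws \<noteq> []" using deg n_ge_2 by (auto simp: edge_degs_def)
  hence "coef ?p (0, {}) = 0"
    by (cases ws) (simp_all add: coef_gvar_mult_zero)
  moreover have "?p \<in> carrier (super_ring k j)" using ws sl by (intro super_add_closed word_closed)
  ultimately have "?p \<in> eigen_invariants" using swap by (simp only: eigen_invariants_def) blast
  thus ?thesis using eigen_invariants_subset_ideal by blast
qed

text \<open>
  Let \<open>A c d f\<close> be the product. Commuting the two letters of equal subscript relates \<open>A c d f\<close> to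
  \<open>A d c f\<close> by the commutation sign (\<open>sym\<close>). The symmetrised mixed pair relates \<open>A c d f\<close> to
  \<open>A c f d\<close> modulo the ideal by the opposite of the commutation sign (\<open>anti\<close>). Six steps that use
  \<open>anti\<close> and \<open>sym\<close> in turn lead from \<open>(c, d, f)\<close> back to itself. Each commutation sign occurs
  twice and cancels, and the three uses of \<open>anti\<close> leave \<open>A c d f \<equiv> - A c d f\<close>.
\<close>

lemma mixed_triple_in_ideal:
  assumes "(c, s) \<in> L" "(d, s) \<in> L" "(f, s) \<in> L"
  shows "gvar (c, s) \<star> gvar (d, s) \<star> gvar (f, other s) \<in> eigen_ideal"
proof -
  define A where "A c d f = gvar (c, s) \<star> gvar (d, s) \<star> gvar (f, other s)" for c d f
  have sym: "A d c f = scl (comm_sign c d) (A c d f)" for c d f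
    unfolding A_def by (subst gvar_commute) (simp add: scl_mult_left comm_sign_commute)
  have anti: "A c d f + scl (comm_sign d f) (A c f d) \<in> eigen_ideal"
    if "(c, s) \<in> L" "(d, s) \<in> L" "(f, s) \<in> L" for c d f
  proof -
    have "word [(d, s), (f, other s)] + word (map swap_letter [(d, s), (f, other s)]) \<in> eigen_ideal"
      using that range_letters_iff[of f s k j "other s"] neq_iff_other[of s 1] exhaust_2[of s]
      by (intro word_symmetrised_in_ideal) (auto simp: edge_degs_def)
    from eigen_ideal_mult(2)[OF this gvar_closed[OF that(1)]]
    have "gvar (c, s) \<star> (gvar (d, s) \<star> gvar (f, other s))
        + gvar (c, s) \<star> (gvar (d, other s) \<star> gvar (f, s)) \<in> eigen_ideal"
      by (simp add: super_mult_add_right)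
    moreover have "gvar (d, other s) \<star> gvar (f, s)
        = scl (comm_sign d f) (gvar (f, s) \<star> gvar (d, other s))"
      by (subst gvar_commute) simp
    ultimately show ?thesis by (simp add: A_def scl_mult_right super_mult_assoc)
  qed
  \<comment> \<open>The three relations of type \<open>anti\<close> along this cycle; half of their signed sum is \<open>A c d f\<close>.\<close>
  define x y z where "x = A c d f + scl (comm_sign d f) (A c f d)"
    and "y = A f c d + scl (comm_sign c d) (A f d c)"
    and "z = A d f c + scl (comm_sign f c) (A d c f)"
  have "x \<in> eigen_ideal" "y \<in> eigen_ideal" "z \<in> eigen_ideal"
    using anti[OF assms(1,2,3)] anti[OF assms(3,1,2)] anti[OF assms(2,3,1)]
    unfolding x_def y_def z_def .
  hence "scl (1/2) (x - scl (comm_sign d f * comm_sign c f) y + scl (comm_sign c f * comm_sign c d) z)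
      \<in> eigen_ideal"
    by (intro eigen_ideal_scl eigen_ideal_add eigen_ideal_diff)
  also have "scl (1/2) (x - scl (comm_sign d f * comm_sign c f) y + scl (comm_sign c f * comm_sign c d) z)
      = A c d f"
    unfolding x_def y_def z_def sym[of c f d] sym[of d f c] sym[of d c f, symmetric]
      sym[of c d f]
    by (rule superpoly_eqI) (simp add: comm_sign_def algebra_simps)
  finally show ?thesis by (simp add: A_def)
qed

lemma mixed_word_in_ideal:
  assumes ws: "set ws \<subseteq> L" and num: "num_letters s ws \<ge> 2" "num_letters (other s) ws \<ge> 1"
  shows "word ws \<in> eigen_ideal"
proof -
  have "num_letters s ws > 0" using num by linarith
  then obtain x us e where x: "snd x = s" "word ws = scl e (word (x # us))" "set (x # us) \<subseteq> set ws"
    "num_letters s ws = Suc (num_letters s us)" "num_letters (other s) ws = num_letters (other s) us"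
    by (rule word_pull_letter)
  have "num_letters s us > 0" using num x(4) by linarith
  then obtain y vs e' where y: "snd y = s" "word us = scl e' (word (y # vs))" "set (y # vs) \<subseteq> set us"
    "num_letters s us = Suc (num_letters s vs)" "num_letters (other s) us = num_letters (other s) vs"
    by (rule word_pull_letter)
  have "num_letters (other s) vs > 0" using num x(5) y(5) by linarith
  then obtain z ts e'' where z: "snd z = other s" "word vs = scl e'' (word (z # ts))"
    "set (z # ts) \<subseteq> set vs"
    by (rule word_pull_letter)
  have mem: "x \<in> L" "y \<in> L" "z \<in> L" "set ts \<subseteq> L" using ws x(3) y(3) z(3) by auto
  have "(fst x, s) \<in> L" "(fst y, s) \<in> L" "(fst z, other s) \<in> L"
    using mem x(1) y(1) z(1) by (metis prod.collapse)+
  moreover from this(3) have "(fst z, s) \<in> L" by (simp only: range_letters_iff[of _ s k j "other s"])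
  ultimately have "gvar (fst x, s) \<star> gvar (fst y, s) \<star> gvar (fst z, other s) \<in> eigen_ideal"
    by (intro mixed_triple_in_ideal)
  hence "gvar x \<star> gvar y \<star> gvar z \<in> eigen_ideal"
    using x(1) y(1) z(1) by (metis prod.collapse)
  hence "gvar x \<star> gvar y \<star> gvar z \<star> word ts \<in> eigen_ideal"
    using mem(4) by (rule eigen_ideal_mult(1)[OF _ word_closed])
  moreover have "word ws = scl (e * e' * e'') (gvar x \<star> gvar y \<star> gvar z \<star> word ts)"
    by (simp add: x(2) y(2) z(2) scl_mult_right super_mult_assoc mult_ac)
  ultimately show ?thesis by (simp add: eigen_ideal_scl)
qed

text \<open>
  Modulo the ideal, \<open>n\<close> of the letters can be replaced by those of the other subscript. One letter
  remains, and \<open>n \<ge> 2\<close>, so the resulting word is mixed and has at least three letters.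
\<close>

lemma pure_word_in_ideal:
  assumes ws: "set ws \<subseteq> L" and num: "num_letters s ws > n" "num_letters (other s) ws = 0"
  shows "word ws \<in> eigen_ideal"
proof -
  have all: "snd x = s" if "x \<in> set ws" for x
    using num(2) that neq_iff_other by (fastforce simp: filter_empty_conv)
  hence "filter (\<lambda>x. snd x = s) ws = ws" by (intro filter_True) auto
  hence len: "length ws > n" using num(1) by simp
  then obtain x ws' where x: "ws = x # ws'" by (cases ws) auto
  define us vs where "us = take n ws'" and "vs = drop n ws'"
  have ws_eq: "ws = x # us @ vs" and us: "length us = n"
    using x len by (simp_all add: us_def vs_def)
  have "num_letters s us = n" "num_letters (other s) us = 0"
    using all us ws_eq other_neq[of s, symmetric] by (auto simp: filter_empty_conv filter_True)
  hence nums: "(num_letters 1 us, num_letters 2 us) \<in> edge_degs"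
    using exhaust_2[of s] by (auto simp: edge_degs_def)
  have sl: "set (x # map swap_letter us) \<subseteq> L"
    using ws ws_eq range_letters_iff by (fastforce simp: swap_letter_def)
  have "gvar x \<star> (word us + word (map swap_letter us)) \<in> eigen_ideal"
    using ws ws_eq nums by (intro eigen_ideal_mult gvar_closed word_symmetrised_in_ideal) auto
  moreover have "word (x # map swap_letter us) \<in> eigen_ideal"
    using sl
  proof (rule mixed_word_in_ideal)
    have "num_letters (other s) (map swap_letter us) = n"
      using \<open>num_letters s us = n\<close> by (simp only: num_letters_swap other_other)
    thus "num_letters (other s) (x # map swap_letter us) \<ge> 2"
      using n_ge_2 by simp
    show "num_letters (other (other s)) (x # map swap_letter us) \<ge> 1"
      using all[of x] x by simp
  qed
  ultimately have "gvar x \<star> (word us + word (map swap_letter us)) - word (x # map swap_letter us)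
      \<in> eigen_ideal" by (rule eigen_ideal_diff)
  hence "word (x # us) \<in> eigen_ideal" by (simp add: super_mult_add_right)
  hence "word (x # us) \<star> word vs \<in> eigen_ideal"
    using ws ws_eq by (intro eigen_ideal_mult word_closed) auto
  thus ?thesis by (simp add: ws_eq word_append super_mult_assoc)
qed

lemma high_smonom_in_ideal:
  assumes M: "M \<in> mons k j" "bidegree M \<notin> small_degs \<union> edge_degs"
  shows "smonom M \<in> eigen_ideal"
proof -
  obtain e ws where ws: "proper ws" "content ws = M" "set ws = letters M" "smonom M = scl e (word ws)"
    using smonom_eq_word[OF mons_finite[OF M(1)]] by metis
  have L: "set ws \<subseteq> L" using letters_subset[OF M(1)] ws(3) by simp
  define a b where "a = num_letters 1 ws" and "b = num_letters 2 ws"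
  have "bidegree M = (a, b)"
    using degree_in_content[OF ws(1)] ws(2) by (simp add: bidegree_def a_def b_def)
  hence "(a \<ge> 2 \<and> b \<ge> 1) \<or> (b \<ge> 2 \<and> a \<ge> 1) \<or> (a > n \<and> b = 0) \<or> (b > n \<and> a = 0)"
    using M(2) by (auto simp: small_degs_def edge_degs_def)
  hence "word ws \<in> eigen_ideal"
    using mixed_word_in_ideal[OF L, of 1] mixed_word_in_ideal[OF L, of 2]
      pure_word_in_ideal[OF L, of 1] pure_word_in_ideal[OF L, of 2]
    by (auto simp: a_def b_def)
  thus ?thesis by (simp add: ws(4) eigen_ideal_scl)
qed

text \<open>
  The component of edge bidegrees is fixed by the exchange, hence an invariant and a generator of
  the ideal. The remaining monomials lie in the ideal by \<open>high_smonom_in_ideal\<close>.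
\<close>

lemma eigen_kernel_subset_ideal: "eigen_kernel \<subseteq> eigen_ideal"
proof
  fix p assume p: "p \<in> eigen_kernel"
  hence pS: "p \<in> carrier (super_ring k j)" by (simp add: eigen_kernel_def)
  define r h where "r = graded_part edge_degs p" and "h = graded_part (- edge_degs) p"
  have ph: "p = r + h" by (rule superpoly_eqI) (simp add: r_def h_def coef_graded_part)
  have rS: "r \<in> carrier (super_ring k j)" "h \<in> carrier (super_ring k j)"
    using pS by (auto simp: r_def h_def carrier_super_ring supp_graded_part)
  have fin: "fin r" "fin h" using rS carrier_fin by auto
  have "h \<in> eigen_ideal"
    unfolding h_def graded_part_def
  proof (intro eigen_ideal_sum eigen_ideal_scl high_smonom_in_ideal)
    fix M assume M: "M \<in> {M \<in> supp p. bidegree M \<in> - edge_degs}"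
    thus "M \<in> mons k j" using pS by (auto simp: carrier_super_ring)
    show "bidegree M \<notin> small_degs \<union> edge_degs"
      using M p unfolding eigen_kernel_def supp_def by blast
  qed
  moreover have "r \<in> eigen_invariants"
  proof -
    have dr: "degs r \<subseteq> edge_degs" "degs h \<inter> edge_degs = {}"
      by (auto simp: degs_def supp_graded_part r_def h_def)
    have dsr: "degs (super_act swap_matrix r) \<subseteq> edge_degs"
      "degs (super_act swap_matrix h) \<inter> edge_degs = {}"
    proof -
      have "prod.swap ` degs r \<subseteq> edge_degs"
        using image_mono[OF dr(1), of prod.swap] unfolding swap_degs(2) .
      thus "degs (super_act swap_matrix r) \<subseteq> edge_degs"
        using degs_act_swap[OF fin(1)] by (rule order_trans[rotated])
      show "degs (super_act swap_matrix h) \<inter> edge_degs = {}"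
        by (rule degs_act_swap_disjoint[OF fin(2) dr(2) swap_degs(2)])
    qed
    have "coef (super_act swap_matrix r) M = coef r M" for M
    proof (cases "bidegree M \<in> edge_degs")
      case True
      hence "coef h M = 0" "coef (super_act swap_matrix h) M = 0"
        using dr(2) dsr(2) unfolding coef_zero_iff_degs[symmetric] by blast+
      moreover have "coef (p - super_act swap_matrix p) M = 0"
        using p True unfolding eigen_kernel_def by blast
      ultimately show ?thesis by (simp add: ph super_act_add)
    next
      case False
      hence "coef r M = 0" "coef (super_act swap_matrix r) M = 0"
        using dr(1) dsr(1) by (auto simp: degs_def supp_def)
      thus ?thesis by simp
    qed
    hence "super_act swap_matrix r = r" by (rule superpoly_eqI)
    moreover have "super_act rot r = r"
    proof (rule superpoly_eqI)
      fix M
      have "inverse zeta ^ degree_in 1 M * zeta ^ degree_in 2 M = 1" if "bidegree M \<in> edge_degs"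
        using that zeta_power by (auto simp: bidegree_def edge_degs_def power_inverse)
      thus "coef (super_act rot r) M = coef r M"
        unfolding coef_act_diag[OF fin(1)] by (simp add: r_def coef_graded_part)
    qed
    moreover have "coef r (0, {}) = 0"
      using n_ge_2 by (simp add: r_def coef_graded_part bidegree_zero edge_degs_def)
    ultimately show ?thesis using rS by (simp add: eigen_invariants_def)
  qed
  ultimately show "p \<in> eigen_ideal"
    using eigen_invariants_subset_ideal by (auto simp: ph intro: eigen_ideal_add)
qed

theorem mem_coinvariant_ideal_iff:
  "f \<in> coinvariant_ideal n k j \<longleftrightarrow> f \<in> carrier (super_ring k j) \<and> super_act eigenbasis_inv f \<in> eigen_kernel"
proof
  assume "f \<in> coinvariant_ideal n k j"
  thus "f \<in> carrier (super_ring k j) \<and> super_act eigenbasis_inv f \<in> eigen_kernel"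
    using coinvariant_ideal_subset by blast
next
  assume f: "f \<in> carrier (super_ring k j) \<and> super_act eigenbasis_inv f \<in> eigen_kernel"
  hence "super_act eigenbasis (super_act eigenbasis_inv f) \<in> coinvariant_ideal n k j"
    using eigen_kernel_subset_ideal by (auto simp: eigen_ideal_def)
  thus "f \<in> coinvariant_ideal n k j"
    using act_eigenbasis_cancel(1)[of f] carrier_fin[of f k j] f by simp
qed

section \<open>A basis of the coinvariant ring\<close>

definition small_mons :: "mon set" where
  "small_mons = {M \<in> mons k j. bidegree M \<in> small_degs}"

lemma edge_reps_in_mons: "M \<in> edge_reps n k j \<Longrightarrow> M \<in> mons k j"
  using colour_pairs_in_range by (auto simp: edge_reps_def mons_deg_def mixed_mon_in_mons)

lemma edge_reps_bidegree: "M \<in> edge_reps n k j \<Longrightarrow> bidegree M \<in> {(n, 0), (1, 1)}"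
  by (auto simp: edge_reps_def mons_deg_def bidegree_mixed_mon)

text \<open>
  The representatives form a transversal: two of them are exchanged only if they coincide, which
  happens only for a fermionic colour paired with itself.
\<close>

lemma edge_reps_swap:
  assumes "M \<in> edge_reps n k j" "swap_mon M \<in> edge_reps n k j"
  shows "swap_mon M = M \<and> swap_sign M = -1"
proof -
  have M: "M \<in> mons k j" "finite (snd M)"
    using edge_reps_in_mons[OF assms(1)] mons_finite by auto
  have "bidegree M \<noteq> (n, 0)"
    using edge_reps_bidegree[OF assms(2)] bidegree_swap_mon[OF M(2)] n_ge_2 by auto
  then obtain c d where M: "M = mixed_mon c d" and cd: "(c, d) \<in> colour_pairs k j"
    using assms(1) by (auto simp: edge_reps_def mons_deg_def)
  have "mixed_mon d c \<notin> mons_deg k j (n, 0)"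
    using n_ge_2 by (simp add: mons_deg_def bidegree_mixed_mon)
  hence "(d, c) \<in> colour_pairs k j"
    using assms(2) unfolding M swap_mixed_mon by (auto simp: edge_reps_def mixed_mon_inject)
  with cd have "c = d" "comm_sign c c = -1" using colour_pairs_antisym by blast+
  thus ?thesis unfolding M by (simp add: swap_mixed_mon swap_sign_mixed_mon)
qed

text \<open>
  An anti-invariant is determined by its coefficients at the representatives: every other edge
  monomial is the exchange of one of these or is itself fixed with sign 1.
\<close>

lemma edge_reps_cover:
  assumes M: "M \<in> mons k j" "bidegree M \<in> edge_degs"
  shows "M \<in> edge_reps n k j \<or> swap_mon M \<in> edge_reps n k j \<or> swap_mon M = M \<and> swap_sign M = 1"
proof -
  have fin: "finite (snd M)" using M(1) by (rule mons_finite)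
  consider "bidegree M = (1, 1)" | "bidegree M = (n, 0)" | "bidegree M = (0, n)"
    using M(2) by (auto simp: edge_degs_def)
  thus ?thesis
  proof cases
    case 1
    then obtain c d where cd: "M = mixed_mon c d" using bidegree_1_1_is_mixed_mon[OF fin] by blast
    hence "(c, 1) \<in> range_letters k j" "(d, 2) \<in> range_letters k j"
      using M(1) by (simp_all add: mixed_mon_in_mons)
    from colour_pairs_total[OF this] show ?thesis
      unfolding cd swap_mixed_mon
      by (elim disjE) (auto simp: edge_reps_def swap_sign_mixed_mon)
  next
    case 2
    thus ?thesis using M(1) by (simp add: edge_reps_def mons_deg_def)
  next
    case 3
    hence "bidegree (swap_mon M) = (n, 0)" by (simp add: bidegree_swap_mon[OF fin])
    thus ?thesis using swap_mon_in_mons[OF M(1)] by (simp add: edge_reps_def mons_deg_def)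
  qed
qed

lemma small_mons_eq: "small_mons = mons_deg k j (0, 0) \<union>
   (\<Union>i\<in>{1..n-1}. mons_deg k j (i, 0) \<union> mons_deg k j (0, i))"
proof -
  have "x \<in> small_degs \<longleftrightarrow> x = (0, 0) \<or> (\<exists>i\<in>{1..n-1}. x = (i, 0) \<or> x = (0, i))" for x
    using n_ge_2 by (cases x) (auto simp: small_degs_def)
  thus ?thesis unfolding small_mons_def mons_deg_def by blast
qed

lemma card_small_mons:
  "card (small_mons) = 1 + 2 * (\<Sum>i=1..n-1. card (mons_deg k j (i, 0)))"
  "finite (small_mons)"
proof -
  have fin: "finite (mons_deg k j (i, 0))" "finite (mons_deg k j (0, i))" for i
    using card_mons_deg_pure(2)[of k j i] mons_deg_swap[of k j 0 i] by auto
  show "finite (small_mons)" unfolding small_mons_eq using fin by simp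
  have disj: "mons_deg k j x \<inter> mons_deg k j y = {}" if "x \<noteq> y" for x y
    using that by (auto simp: mons_deg_def)
  have "card (mons_deg k j (i, 0) \<union> mons_deg k j (0, i)) = 2 * card (mons_deg k j (i, 0))"
    if "i \<in> {1..n-1}" for i
  proof -
    have "card (mons_deg k j (0, i)) = card (mons_deg k j (i, 0))"
      unfolding mons_deg_swap[of k j 0 i] by (rule card_image) (rule inj_swap_mon)
    thus ?thesis using that disj[of "(i, 0)" "(0, i)"] fin by (simp add: card_Un_disjoint)
  qed
  moreover have "card (\<Union>i\<in>{1..n-1}. mons_deg k j (i, 0) \<union> mons_deg k j (0, i))
      = (\<Sum>i=1..n-1. card (mons_deg k j (i, 0) \<union> mons_deg k j (0, i)))"
    using fin by (intro card_UN_disjoint) (auto simp: mons_deg_def)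
  moreover have "card (small_mons) = card (mons_deg k j (0, 0)) +
      card (\<Union>i\<in>{1..n-1}. mons_deg k j (i, 0) \<union> mons_deg k j (0, i))"
    unfolding small_mons_eq using fin by (intro card_Un_disjoint) (auto simp: mons_deg_def)
  ultimately show "card (small_mons) = 1 + 2 * (\<Sum>i=1..n-1. card (mons_deg k j (i, 0)))"
    by (simp add: mons_deg_zero sum_distrib_left)
qed

lemma edge_reps_disjoint_small: "small_mons \<inter> edge_reps n k j = {}"
proof -
  have "bidegree M \<notin> small_degs" if "M \<in> edge_reps n k j" for M
    using edge_reps_bidegree[OF that] n_ge_2 by (auto simp: small_degs_def)
  thus ?thesis by (auto simp: small_mons_def)
qed

lemma card_edge_reps:
  "card (edge_reps n k j) = card (mons_deg k j (n, 0)) + ((k choose 2) + k * j + ((j + 1) choose 2))"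
  "finite (edge_reps n k j)"
proof -
  have "card ((\<lambda>(c, d). mixed_mon c d) ` colour_pairs k j) = card (colour_pairs k j)"
    by (rule card_image) (auto simp: inj_on_def mixed_mon_inject)
  moreover have "mons_deg k j (n, 0) \<inter> (\<lambda>(c, d). mixed_mon c d) ` colour_pairs k j = {}"
    using n_ge_2 by (auto simp: mons_deg_def bidegree_mixed_mon)
  ultimately show "card (edge_reps n k j)
      = card (mons_deg k j (n, 0)) + ((k choose 2) + k * j + ((j + 1) choose 2))"
    unfolding edge_reps_def
    by (simp add: card_Un_disjoint card_mons_deg_pure(2) finite_colour_pairs card_colour_pairs)
  show "finite (edge_reps n k j)"
    unfolding edge_reps_def by (simp add: card_mons_deg_pure(2) finite_colour_pairs)
qed

text \<open>
  In edge bidegrees the kernel asks that \<open>q\<close> be fixed by the exchange, so the functional reads off the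
  anti-invariant part of \<open>q\<close>, up to a factor 2.
\<close>

definition functional :: "mon \<Rightarrow> superpoly \<Rightarrow> complex" where
  "functional M p = (let q = super_act eigenbasis_inv p in
     if bidegree M \<in> small_degs then coef q M else coef (q - super_act swap_matrix q) M)"

text \<open>
  For a fermionic colour paired with itself, \<open>q - \<sigma> q\<close> doubles the coefficient of the monomial,
  hence the factor \<open>1/2\<close>.
\<close>

definition dual_vector :: "mon \<Rightarrow> superpoly" where
  "dual_vector M = super_act eigenbasis (scl (if swap_mon M = M \<and> swap_sign M = -1 then 1/2 else 1) (smonom M))"

abbreviation "basis_mons \<equiv> small_mons \<union> edge_reps n k j"

lemma functional_dual_vector:
  assumes M: "M \<in> basis_mons" and N: "N \<in> basis_mons"
  shows "functional N (dual_vector M) = (if M = N then 1 else 0)"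
proof -
  define d where "d = (if swap_mon M = M \<and> swap_sign M = -1 then 1/2 else 1 :: complex)"
  have Mm: "M \<in> mons k j" using M edge_reps_in_mons unfolding small_mons_def by blast
  hence fin: "finite (snd M)" by (rule mons_finite)
  have fin': "fin (scl d (smonom M))" using fin by (intro fin_scl) (simp add: fin_iff_supp)
  have q: "super_act eigenbasis_inv (dual_vector M) = scl d (smonom M)"
    unfolding dual_vector_def d_def[symmetric] by (rule act_eigenbasis_cancel(2)[OF fin'])
  have c1: "coef (scl d (smonom M)) N = (if M = N then d else 0)" by (simp add: coef_smonom)
  have c2: "coef (super_act swap_matrix (scl d (smonom M))) N
      = (if swap_mon M = N then d * swap_sign M else 0)"
    by (simp add: super_act_scl swap_sign(2)[OF fin] coef_smonom)
  show ?thesis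
  proof (cases "bidegree N \<in> small_degs")
    case small: True
    have "d = 1" if "M = N"
    proof -
      have "bidegree M \<in> small_degs" using small that by simp
      then obtain a b where ab: "bidegree M = (a, b)" "a = 0 \<or> b = 0" "a + b < n"
        by (auto simp: small_degs_def)
      show "d = 1"
      proof (cases "a + b = 0")
        case True
        hence M0: "M = (0, {})" using bidegree_eq_zero[OF fin] ab by simp
        hence "smonom M = sone" by (simp add: smonom_one)
        hence "swap_sign M = coef sone (swap_mon M)" by (simp add: swap_sign_def)
        hence "swap_sign M \<noteq> -1" by (simp add: coef_smonom flip: smonom_one)
        thus ?thesis by (simp add: d_def)
      next
        case False
        hence "swap_mon M \<noteq> M" using bidegree_swap_mon[OF fin] ab by auto
        thus ?thesis by (simp add: d_def)
      qed
    qed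
    thus ?thesis using small by (simp add: functional_def q c1 del: coef_scl)
  next
    case False
    hence N': "N \<in> edge_reps n k j" using N by (auto simp: small_mons_def)
    have f: "functional N (dual_vector M) = (if M = N then d else 0) - (if swap_mon M = N then d * swap_sign M else 0)"
      using False by (simp add: functional_def q c1 c2 Let_def del: coef_scl)
    show ?thesis
    proof (cases "swap_mon M = N")
      case True
      have "bidegree M \<notin> small_degs"
      proof
        assume "bidegree M \<in> small_degs"
        hence "bidegree N \<in> small_degs"
          using bidegree_swap_mon[OF fin] True swap_degs(1) by (metis image_eqI)
        thus False using False by simp
      qed
      hence "M \<in> edge_reps n k j" using M by (auto simp: small_mons_def)
      hence "swap_mon M = M" "swap_sign M = -1" using edge_reps_swap True N' by blast+
      thus ?thesis using True unfolding f d_def by simp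
    next
      case False
      have "d = 1" if "M = N" using that False by (simp add: d_def)
      thus ?thesis using False unfolding f by simp
    qed
  qed
qed

text \<open>
  The kernel imposes a condition for every edge monomial. As \<open>q - \<sigma> q\<close> is anti-invariant, those at
  the representatives imply the others.
\<close>

lemma mem_coinvariant_ideal_iff_functionals:
  "f \<in> coinvariant_ideal n k j \<longleftrightarrow> f \<in> carrier (super_ring k j) \<and> (\<forall>M\<in>basis_mons. functional M f = 0)"
proof (cases "f \<in> carrier (super_ring k j)")
  case False
  thus ?thesis using mem_coinvariant_ideal_iff by blast
next
  case f: True
  define q where "q = super_act eigenbasis_inv f"
  define r where "r = q - super_act swap_matrix q"
  have q: "q \<in> carrier (super_ring k j)" and r: "r \<in> carrier (super_ring k j)"
    using f by (auto simp: q_def r_def super_act_closed super_diff_closed)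
  have fin: "fin q" "fin r" using q r carrier_fin by blast+
  have outside: "coef q M = 0" "coef r M = 0" if "M \<notin> mons k j" for M
    using q r that by (auto simp: carrier_super_ring supp_def)
  have anti: "super_act swap_matrix r = - r"
  proof -
    have "super_act swap_matrix (super_act swap_matrix q) = q"
    proof (rule superpoly_eqI)
      fix M
      have "swap_matrix ** swap_matrix = mat 1"
        by (simp add: matrix_eq_2 matrix_mult_2 swap_matrix_def mat_def)
      thus "coef (super_act swap_matrix (super_act swap_matrix q)) M = coef q M"
        using super_act_matrix_mult[OF fin(1), of swap_matrix swap_matrix] super_act_one[OF fin(1)] by simp
    qed
    thus ?thesis by (simp add: r_def super_act_diff)
  qed
  have fun_small: "functional M f = coef q M" if "bidegree M \<in> small_degs" for M
    using that by (simp add: functional_def q_def)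
  have fun_edge: "functional M f = coef r M" if "bidegree M \<notin> small_degs" for M
    using that by (simp add: functional_def q_def r_def Let_def)
  have reps: "bidegree M \<notin> small_degs" if "M \<in> edge_reps n k j" for M
    using that edge_reps_disjoint_small edge_reps_in_mons[OF that] unfolding small_mons_def by blast
  have "f \<in> coinvariant_ideal n k j \<longleftrightarrow> q \<in> eigen_kernel"
    using mem_coinvariant_ideal_iff f by (simp add: q_def)
  also have "\<dots> \<longleftrightarrow> (\<forall>M. bidegree M \<in> small_degs \<longrightarrow> coef q M = 0) \<and>
      (\<forall>M. bidegree M \<in> edge_degs \<longrightarrow> coef r M = 0)"
    using q unfolding eigen_kernel_def r_def by blast
  also have "(\<forall>M. bidegree M \<in> small_degs \<longrightarrow> coef q M = 0)
      \<longleftrightarrow> (\<forall>M\<in>small_mons. functional M f = 0)"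
    using outside(1) fun_small unfolding small_mons_def by fastforce
  also have "(\<forall>M. bidegree M \<in> edge_degs \<longrightarrow> coef r M = 0)
      \<longleftrightarrow> (\<forall>M\<in>edge_reps n k j. functional M f = 0)"
  proof (intro iffI ballI allI impI)
    fix M assume *: "\<forall>M. bidegree M \<in> edge_degs \<longrightarrow> coef r M = 0" and M: "M \<in> edge_reps n k j"
    have "bidegree M \<in> edge_degs" using edge_reps_bidegree[OF M] by (auto simp: edge_degs_def)
    hence "coef r M = 0" using * by blast
    thus "functional M f = 0" using fun_edge[OF reps[OF M]] by simp
  next
    fix M assume *: "\<forall>M\<in>edge_reps n k j. functional M f = 0" and deg: "bidegree M \<in> edge_degs"
    have sw: "- coef r (swap_mon M) = swap_sign M * coef r M"
      using coef_act_swap[OF fin(2), of M] by (simp add: anti)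
    have zero: "coef r N = 0" if "N \<in> edge_reps n k j" for N
      using * that fun_edge[OF reps[OF that]] by simp
    show "coef r M = 0"
    proof (cases "M \<in> mons k j")
      case False
      thus ?thesis by (rule outside(2))
    next
      case True
      have "swap_sign M \<noteq> 0" using swap_sign(1)[OF mons_finite[OF True]] by auto
      with edge_reps_cover[OF True deg] show ?thesis
        using sw zero[of M] zero[of "swap_mon M"] by (elim disjE) simp_all
    qed
  qed
  finally show ?thesis using f by blast
qed

lemma card_basis_mons: "card basis_mons = 1 + (k choose 2) + k * j + ((j + 1) choose 2)
      + (\<Sum>h=0..n. (j choose h) * num_monomials k (n - h))
      + 2 * (\<Sum>i=1..n-1. \<Sum>h=0..i. (j choose h) * num_monomials k (i - h))"
proof -
  have "card basis_mons = card (small_mons) + card (edge_reps n k j)"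
    using card_small_mons(2) card_edge_reps(2) edge_reps_disjoint_small by (rule card_Un_disjoint)
  thus ?thesis unfolding card_small_mons(1) card_edge_reps(1) card_mons_deg_pure(1) by simp
qed

lemma dimension_coinvariant_ring:
  "ring.dimension (coinvariant_ring n k j) (card basis_mons)
    (coinvariant_scalars n k j) (carrier (coinvariant_ring n k j))"
  unfolding coinvariant_ring_def coinvariant_scalars_def
proof (rule dimension_quotient_by_functionals[where \<phi> = functional and e = dual_vector])
  show "ideal (coinvariant_ideal n k j) (super_ring k j)"
    by (rule ideal_coinvariant)
  show "finite basis_mons" using card_small_mons(2) card_edge_reps(2) by simp
  show "functional M (p + q) = functional M p + functional M q" for M p q
    by (simp add: functional_def Let_def super_act_add)
  show "functional M (scl c p) = c * functional M p" for M c p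
    by (simp add: functional_def Let_def super_act_scl algebra_simps)
  show "dual_vector M \<in> carrier (super_ring k j)" if "M \<in> basis_mons" for M
  proof -
    have "M \<in> mons k j" using that edge_reps_in_mons unfolding small_mons_def by blast
    thus ?thesis unfolding dual_vector_def by (intro super_act_closed scl_closed) (simp add: smonom_in_carrier_iff)
  qed
qed (use functional_dual_vector mem_coinvariant_ideal_iff_functionals in auto)

end

theorem corollary4p2:
  fixes n k j :: nat
  assumes "n \<ge> 2"
  shows "ring.dimension (coinvariant_ring n k j)
    (1 + (k choose 2) + k * j + ((j + 1) choose 2)
      + (\<Sum>h=0..n. (j choose h) * num_monomials k (n - h))
      + 2 * (\<Sum>i=1..n-1. \<Sum>h=0..i. (j choose h) * num_monomials k (i - h)))
    (coinvariant_scalars n k j) (carrier (coinvariant_ring n k j))"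
  using dimension_coinvariant_ring[OF assms, of k j]
  unfolding card_basis_mons[OF assms, of k j] .

end
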